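(* Let $N$, $\Pi$ be the counting functions of a Beurling generalized number system with zeta function $\zeta(s)=\int_{1^-}^\infty x^{-s}dN(x)=\exp\left(\int_1^\infty x^{-s}d\Pi(x)\right)$, and suppose $N(x)\sim ax$ for some $a>0$. Suppose there are a discrete set of points $0<t_1<t_2<\dots$ and constants $\beta_1,\beta_2,\dots<1$ such that for each $T>0$ there is $K_T>0$ with $$\log|\zeta(\sigma+it)|>-K_T-\log|\sigma-1+it|+\sum_{0<t_n<T}\beta_n\log|\sigma-1+i(t-t_n)|$$ for every $0<t<T$ and $1<\sigma<2$. Then $m(x)=o(1)$ as $x\to\infty$.
   Context: A Beurling generalized prime system is a non-decreasing unbounded sequence of reals $1<p_1\le p_2\le\dots$; the generalized integers are the multiplicative semigroup generated by the $p_k$ and $1$, listed with multiplicity as $1=n_0<n_1\le n_2\le\dots$. $N(x)=\sum_{n_k\le x}1$, $\pi(x)=\sum_{p_k\le x}1$, $\Pi(x)=\sum_{j\ge1}\frac1j\pi(x^{1/j})$. The measure $dM$ is the multiplicative convolution inverse of $dN$, i.e. $\int_{1^-}^\infty x^{-s}dM(x)=1/\zeta(s)$, and $m(x)=\int_{1^-}^x dM(t)/t$; for discrete systems $m(x)=\sum_{n_k\le x}\mu(n_k)/n_k$ with $\mu$ the Beurling analogue of the Möbius function. *)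

theory Defs
  imports "HOL-Analysis.Analysis" "HOL-Library.Multiset" "HOL-Library.Landau_Symbols"
begin

definition beurling_primes :: "(nat \<Rightarrow> real) \<Rightarrow> bool" where
  "beurling_primes p \<longleftrightarrow> 1 < p 0 \<and> mono p \<and> \<not> bdd_above (range p)"

text \<open>
  A generalized integer, counted with multiplicity, is a finite multiset of indices of
  generalized primes; its value is the product of the corresponding primes. Different
  multisets with the same value are different entries of the list
  \<open>n\<^sub>0 < n\<^sub>1 \<le> n\<^sub>2 \<le> \<dots>\<close>; the empty multiset is \<open>n\<^sub>0 = 1\<close>.
\<close>

definition beurling_int :: "(nat \<Rightarrow> real) \<Rightarrow> nat multiset \<Rightarrow> real" where
  "beurling_int p A = (\<Prod>k\<in>#A. p k)"

definition beurling_N :: "(nat \<Rightarrow> real) \<Rightarrow> real \<Rightarrow> real" where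
  "beurling_N p x = real (card {A. beurling_int p A \<le> x})"

definition beurling_pi :: "(nat \<Rightarrow> real) \<Rightarrow> real \<Rightarrow> real" where
  "beurling_pi p x = real (card {k. p k \<le> x})"

definition beurling_Pi :: "(nat \<Rightarrow> real) \<Rightarrow> real \<Rightarrow> real" where
  "beurling_Pi p x = (\<Sum>j. beurling_pi p (root (Suc j) x) / real (Suc j))"

text \<open>
  The Stieltjes measures \<open>dN\<close> and \<open>d\<Pi>\<close> are \<^const>\<open>interval_measure\<close> of the counting functions.
\<close>

definition beurling_zeta :: "(nat \<Rightarrow> real) \<Rightarrow> complex \<Rightarrow> complex" where
  "beurling_zeta p s =
     (LINT x:{1..}|interval_measure (beurling_N p). complex_of_real x powr (-s))"

definition beurling_mu :: "nat multiset \<Rightarrow> real" where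
  "beurling_mu A = (if \<forall>k. count A k \<le> 1 then (- 1) ^ size A else 0)"

text \<open>
  The measure \<open>dM\<close> has mass \<open>\<mu>(A)\<close> at each generalized integer \<open>A\<close>. That it is the convolution
  inverse of \<open>dN\<close> is \<open>beurling_mu_convolution\<close>, and \<open>\<integral> x\<^sup>-\<^sup>s dM(x) = 1 / \<zeta>(s)\<close> is \<open>beurling_zeta_mu\<close> below;
  \<open>\<integral> dM(t) / t\<close> over \<open>[1, x]\<close> is then the following finite sum.
\<close>

definition beurling_m :: "(nat \<Rightarrow> real) \<Rightarrow> real \<Rightarrow> real" where
  "beurling_m p x = (\<Sum>A | beurling_int p A \<le> x. beurling_mu A / beurling_int p A)"

subsection \<open>The Stieltjes measure of a discrete counting function\<close>

lemma discrete_counting: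
  fixes f w :: "'i \<Rightarrow> real"
  assumes fin: "\<And>x. finite {i. f i \<le> x}" and w: "\<And>i. 0 \<le> w i"
  defines "F \<equiv> \<lambda>x. \<Sum>i | f i \<le> x. w i"
  shows discrete_counting_mono: "mono F"
    and discrete_counting_right_cont: "\<And>x. continuous (at_right x) F"
    and interval_measure_discrete:
      "interval_measure F = distr (density (count_space UNIV) (\<lambda>i. ennreal (w i))) borel f"
proof -
  show mono: "mono F"
    unfolding F_def by (intro monoI sum_mono2 fin) (auto intro: w)
  show cont: "continuous (at_right x) F" for x
  proof -
    define B where "B = f ` {i. f i \<le> x + 1 \<and> x < f i}"
    have finB: "finite B" unfolding B_def
      by (rule finite_imageI, rule finite_subset[OF _ fin[of "x + 1"]]) auto
    define y where "y = Min (insert (x + 1) B)"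
    have "x < y" unfolding y_def using finB by (subst Min_gr_iff) (auto simp: B_def)
    have "F z = F x" if "x < z" "z < y" for z
    proof -
      have "{i. f i \<le> z} = {i. f i \<le> x}"
      proof (intro equalityI subsetI; clarsimp)
        fix i assume i: "f i \<le> z"
        show "f i \<le> x"
        proof (rule ccontr)
          assume "\<not> f i \<le> x"
          moreover have "y \<le> x + 1" unfolding y_def using finB by simp
          ultimately have "f i \<in> B" using i that unfolding B_def by auto
          hence "y \<le> f i" unfolding y_def using finB by simp
          thus False using i that by simp
        qed
      qed (use that in auto)
      thus ?thesis by (simp add: F_def)
    qed
    hence "eventually (\<lambda>z. F z = F x) (at_right x)"
      using \<open>x < y\<close> by (auto simp: eventually_at_right)
    thus ?thesis unfolding continuous_within by (rule tendsto_eventually)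
  qed
  let ?D = "distr (density (count_space UNIV) (\<lambda>i. ennreal (w i))) borel f"
  have IM: "emeasure (interval_measure F) {a<..b} = ennreal (if a \<le> b then F b - F a else 0)" for a b
    by (subst emeasure_interval_measure_Ioc_eq) (use mono cont in \<open>auto simp: mono_def\<close>)
  have D: "emeasure ?D {a<..b} = ennreal (if a \<le> b then F b - F a else 0)" for a b
  proof -
    have fin': "finite {i. a < f i \<and> f i \<le> b}"
      by (rule finite_subset[OF _ fin[of b]]) auto
    have "emeasure ?D {a<..b} = emeasure (density (count_space UNIV) (\<lambda>i. ennreal (w i))) {i. a < f i \<and> f i \<le> b}"
      by (subst emeasure_distr) (auto intro!: arg_cong2[where f = emeasure])
    also have "\<dots> = (\<integral>\<^sup>+i. ennreal (w i) * indicator {i. a < f i \<and> f i \<le> b} i \<partial>count_space UNIV)"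
      by (subst emeasure_density) auto
    also have "\<dots> = (\<Sum>i | a < f i \<and> f i \<le> b. ennreal (w i))"
      by (subst nn_integral_count_space'[OF fin']) (auto simp: indicator_def)
    also have "\<dots> = ennreal (\<Sum>i | a < f i \<and> f i \<le> b. w i)"
      by (rule sum_ennreal) (rule w)
    also have "(\<Sum>i | a < f i \<and> f i \<le> b. w i) = (if a \<le> b then F b - F a else 0)"
    proof (cases "a \<le> b")
      case True
      have "{i. a < f i \<and> f i \<le> b} = {i. f i \<le> b} - {i. f i \<le> a}" by auto
      moreover have "{i. f i \<le> a} \<subseteq> {i. f i \<le> b}" using True by auto
      ultimately show ?thesis using True by (simp add: F_def sum_diff[OF fin])
    next
      case False
      hence "{i. a < f i \<and> f i \<le> b} = {}" by auto
      thus ?thesis using False by (simp only: sum.empty if_False)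
    qed
    finally show ?thesis .
  qed
  have sets: "sets (borel :: real measure) = sigma_sets UNIV (range (\<lambda>(a, b). {a<..b::real}))"
    by (subst borel_sigma_sets_Ioc) simp
  show "interval_measure F = ?D"
  proof (rule measure_eqI_generator_eq[where \<Omega> = UNIV
        and E = "range (\<lambda>(a, b). {a<..b::real})" and A = "\<lambda>n. {- real n<..real n}"])
    show "Int_stable (range (\<lambda>(a, b). {a<..b::real}))"
      by (auto simp: Int_stable_def image_iff Int_greaterThanAtMost)
    show "(\<Union>n. {- real n<..real n}) = UNIV"
    proof (intro set_eqI iffI UNIV_I)
      fix x :: real
      obtain n :: nat where "\<bar>x\<bar> < real n" using reals_Archimedean2 by blast
      thus "x \<in> (\<Union>n. {- real n<..real n})" by (intro UN_I[of n]) auto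
    qed
  qed (auto simp: IM D sets)
qed

lemma LINT_discrete:
  fixes f w :: "'i \<Rightarrow> real" and g :: "real \<Rightarrow> complex"
  assumes fin: "\<And>x. finite {i. f i \<le> x}" and w: "\<And>i. 0 \<le> w i"
    and f1: "\<And>i. 1 \<le> f i" and g: "continuous_on {1..} g"
    and sm: "(\<lambda>i. w i * norm (g (f i))) summable_on UNIV"
  shows "(LINT x:{1..}|interval_measure (\<lambda>x. \<Sum>i | f i \<le> x. w i). g x) =
         (\<Sum>\<^sub>\<infinity>i. of_real (w i) * g (f i))"
proof -
  have "(LINT x:{1..}|interval_measure (\<lambda>x. \<Sum>i | f i \<le> x. w i). g x) =
        (LINT i|density (count_space UNIV) (\<lambda>i. ennreal (w i)). indicator {1..} (f i) *\<^sub>R g (f i))"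
    unfolding interval_measure_discrete[OF fin w] set_lebesgue_integral_def
    by (rule integral_distr)
       (use borel_measurable_continuous_on_indicator[OF _ g] in auto)
  also have "\<dots> = (LINT i|count_space UNIV. w i *\<^sub>R g (f i))"
    by (subst integral_density) (auto simp: f1 w)
  also have "\<dots> = infsetsum (\<lambda>i. of_real (w i) * g (f i)) UNIV"
    by (simp add: infsetsum_def scaleR_conv_of_real)
  also have "\<dots> = (\<Sum>\<^sub>\<infinity>i. of_real (w i) * g (f i))"
    by (rule infsetsum_infsum)
       (use sm w in \<open>simp add: norm_mult flip: abs_summable_equivalent\<close>)
  finally show ?thesis .
qed

subsection \<open>Basic properties\<close>

lemma beurling_primes_gt_1:
  assumes "beurling_primes p" shows "1 < p k"
  using assms unfolding beurling_primes_def by (meson le0 less_le_trans monoD)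

lemma finite_beurling_primes_le:
  assumes "beurling_primes p" shows "finite {k. p k \<le> x}"
proof -
  obtain n where "x < p n"
    using assms unfolding beurling_primes_def bdd_above_def by (auto simp: not_le)
  hence "{k. p k \<le> x} \<subseteq> {..<n}"
    using assms unfolding beurling_primes_def mono_def
    by (auto, metis le_less_trans less_irrefl not_le order_trans)
  thus ?thesis by (rule finite_subset) simp
qed

lemma beurling_int_empty [simp]: "beurling_int p {#} = 1"
  and beurling_int_add_mset [simp]: "beurling_int p (add_mset k A) = p k * beurling_int p A"
  and beurling_int_plus [simp]: "beurling_int p (A + B) = beurling_int p A * beurling_int p B"
  by (simp_all add: beurling_int_def)

lemma beurling_int_ge:
  assumes "beurling_primes p" shows "p 0 ^ size A \<le> beurling_int p A"
proof (induction A)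
  case (add k A)
  have "1 < p 0" "p 0 \<le> p k" using assms unfolding beurling_primes_def by (auto intro: monoD)
  thus ?case using add by (auto intro: mult_mono)
qed simp

lemma beurling_int_ge_1:
  assumes "beurling_primes p" shows "1 \<le> beurling_int p A"
proof -
  have "1 \<le> p 0 ^ size A" using beurling_primes_gt_1[OF assms, of 0] by (simp add: one_le_power)
  thus ?thesis using beurling_int_ge[OF assms, of A] by linarith
qed

lemma finite_beurling_int_le:
  assumes "beurling_primes p" shows "finite {A. beurling_int p A \<le> x}"
proof -
  obtain n where n: "x < p 0 ^ n"
    using real_arch_pow[OF beurling_primes_gt_1[OF assms, of 0]] by blast
  let ?S = "{k. p k \<le> x}"
  have "{A. beurling_int p A \<le> x} \<subseteq> (\<Union>j\<in>{..<n}. {A. set_mset A \<subseteq> ?S \<and> size A = j})"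
  proof clarify
    fix A assume A: "beurling_int p A \<le> x"
    have "p 0 ^ size A < p 0 ^ n" using beurling_int_ge[OF assms, of A] A n by linarith
    hence "size A < n" using beurling_primes_gt_1[OF assms, of 0] by (simp add: power_less_imp_less_exp)
    moreover have "p k \<le> x" if k: "k \<in># A" for k
    proof -
      obtain B where B: "A = add_mset k B" using k by (metis mset_add)
      have "p k * 1 \<le> p k * beurling_int p B"
        using beurling_int_ge_1[OF assms, of B] beurling_primes_gt_1[OF assms, of k]
        by (intro mult_left_mono) auto
      thus ?thesis using A B by simp
    qed
    ultimately show "A \<in> (\<Union>j\<in>{..<n}. {A. set_mset A \<subseteq> ?S \<and> size A = j})" by auto
  qed
  moreover have "finite (\<Union>j\<in>{..<n}. {A. set_mset A \<subseteq> ?S \<and> size A = j})"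
    using finite_beurling_primes_le[OF assms] by (auto simp flip: multisets_of_size_def intro!: finite_UN_I)
  ultimately show ?thesis by (rule finite_subset)
qed

lemma beurling_N_eq_sum: "beurling_N p = (\<lambda>x. \<Sum>A | beurling_int p A \<le> x. 1)"
  by (simp add: beurling_N_def fun_eq_iff)

lemma finite_beurling_prime_powers_le:
  assumes "beurling_primes p" shows "finite {(j, k). p k ^ Suc j \<le> x}"
proof -
  have "(\<lambda>(j, k). replicate_mset (Suc j) k) ` {(j, k). p k ^ Suc j \<le> x} \<subseteq> {A. beurling_int p A \<le> x}"
    by (auto simp: beurling_int_def)
  moreover have "inj_on (\<lambda>(j, k). replicate_mset (Suc j) k) {(j, k). p k ^ Suc j \<le> x}"
    by (auto simp: inj_on_def) (metis add_mset_eq_singleton_iff count_add_mset count_replicate_mset nat.inject zero_less_Suc nat_neq_iff)+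
  ultimately show ?thesis using finite_beurling_int_le[OF assms] by (metis finite_imageD finite_subset)
qed

lemma beurling_Pi_eq_sum:
  assumes "beurling_primes p"
  shows "beurling_Pi p = (\<lambda>x. \<Sum>(j, k) | p k ^ Suc j \<le> x. 1 / real (Suc j))"
proof
  fix x
  let ?S = "{(j, k). p k ^ Suc j \<le> x}"
  have root: "p k \<le> root (Suc j) x \<longleftrightarrow> p k ^ Suc j \<le> x" for j k
  proof -
    have "p k = root (Suc j) (p k ^ Suc j)"
      using beurling_primes_gt_1[OF assms, of k] by (metis real_root_power_cancel zero_less_Suc less_imp_le less_trans zero_less_one)
    thus ?thesis by (metis real_root_le_iff zero_less_Suc)
  qed
  note fin = finite_beurling_prime_powers_le[OF assms, of x]
  have "beurling_Pi p x = (\<Sum>j\<in>fst ` ?S. beurling_pi p (root (Suc j) x) / real (Suc j))"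
    unfolding beurling_Pi_def
  proof (rule suminf_finite)
    fix j assume "j \<notin> fst ` ?S"
    hence "{k. p k \<le> root (Suc j) x} = {}" unfolding root by force
    thus "beurling_pi p (root (Suc j) x) / real (Suc j) = 0" by (simp add: beurling_pi_def)
  qed (use fin in simp)
  also have "\<dots> = (\<Sum>j\<in>fst ` ?S. \<Sum>k | p k ^ Suc j \<le> x. 1 / real (Suc j))"
    unfolding beurling_pi_def root by simp
  also have "\<dots> = (\<Sum>(j, k)\<in>Sigma (fst ` ?S) (\<lambda>j. {k. p k ^ Suc j \<le> x}). 1 / real (Suc j))"
  proof (rule sum.Sigma)
    show "finite (fst ` ?S)" using fin by simp
    show "\<forall>j\<in>fst ` ?S. finite {k. p k ^ Suc j \<le> x}"
      using finite_beurling_primes_le[OF assms, of "root (Suc _) x"] unfolding root by simp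
  qed
  also have "Sigma (fst ` ?S) (\<lambda>j. {k. p k ^ Suc j \<le> x}) = ?S" by force
  finally show "beurling_Pi p x = (\<Sum>(j, k)\<in>?S. 1 / real (Suc j))" .
qed

lemma beurling_mu_convolution:
  "(\<Sum>B | B \<subseteq># A. beurling_mu B) = (if A = {#} then 1 else 0)"
proof -
  have "{B. B \<subseteq># A} \<subseteq> (\<Union>n\<in>{..size A}. multisets_of_size (set_mset A) n)"
    by (auto simp: multisets_of_size_def size_mset_mono dest: mset_subset_eqD)
  hence fin: "finite {B. B \<subseteq># A}"
    by (rule finite_subset) auto
  have "(\<Sum>B | B \<subseteq># A. beurling_mu B) = (\<Sum>B | B \<subseteq># A \<and> (\<forall>k. count B k \<le> 1). (-1) ^ size B)"
    by (rule sum.mono_neutral_cong_right) (use fin in \<open>auto simp: beurling_mu_def\<close>)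
  also have "\<dots> = (\<Sum>S\<in>Pow (set_mset A). (-1) ^ card S)"
  proof (rule sum.reindex_bij_witness[where i = mset_set and j = set_mset])
    fix B assume "B \<in> {B. B \<subseteq># A \<and> (\<forall>k. count B k \<le> 1)}"
    hence *: "B \<subseteq># A" "\<And>k. count B k \<le> 1" by auto
    show B: "mset_set (set_mset B) = B"
    proof (rule multiset_eqI)
      fix k show "count (mset_set (set_mset B)) k = count B k"
        using *(2)[of k] by (cases "count B k") (simp_all add: count_mset_set' not_in_iff flip: count_greater_zero_iff)
    qed
    show "set_mset B \<in> Pow (set_mset A)" using * by (auto dest: mset_subset_eqD)
    show "(-1::real) ^ card (set_mset B) = (-1) ^ size B"
      by (metis B size_mset_set)
  next
    fix S assume S: "S \<in> Pow (set_mset A)"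
    hence finS: "finite S" by (auto intro: finite_subset)
    show "set_mset (mset_set S) = S" using finS by simp
    show "mset_set S \<in> {B. B \<subseteq># A \<and> (\<forall>k. count B k \<le> 1)}"
      using S finS by (auto simp: subseteq_mset_def count_mset_set' Suc_le_eq)
  qed
  also have "\<dots> = (if A = {#} then 1 else 0)"
  proof (cases "A = {#}")
    case False
    then obtain k where k: "k \<in># A" by auto
    let ?P = "Pow (set_mset A - {k})"
    have "Pow (set_mset A) = ?P \<union> insert k ` ?P"
      using k by (metis Pow_insert insert_Diff)
    moreover have "(\<Sum>S\<in>?P \<union> insert k ` ?P. (-1::real) ^ card S) =
        (\<Sum>S\<in>?P. (-1) ^ card S) + (\<Sum>S\<in>insert k ` ?P. (-1) ^ card S)"
      by (rule sum.union_disjoint) auto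
    moreover have "(\<Sum>S\<in>insert k ` ?P. (-1::real) ^ card S) = (\<Sum>S\<in>?P. - ((-1) ^ card S))"
    proof (subst sum.reindex)
      show "inj_on (insert k) ?P"
        by (rule inj_onI) (metis Diff_insert_absorb DiffE PowD insertI1 subsetD)
      show "sum ((\<lambda>S. (-1::real) ^ card S) \<circ> insert k) ?P = (\<Sum>S\<in>?P. - ((-1) ^ card S))"
      proof (rule sum.cong)
        fix S assume "S \<in> ?P"
        hence "finite S" "k \<notin> S" by (auto intro: finite_subset)
        thus "((\<lambda>S. (-1::real) ^ card S) \<circ> insert k) S = - ((-1) ^ card S)" by simp
      qed simp
    qed
    ultimately show ?thesis using False by (simp add: sum_negf)
  qed simp
  finally show ?thesis .
qed

subsection \<open>The zeta function in the half-plane of convergence\<close>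

lemma tendsto_infsum_exhaust:
  fixes f :: "'a \<Rightarrow> complex"
  assumes f: "(\<lambda>x. norm (f x)) summable_on UNIV" and S: "incseq S" "(\<Union>n. S n) = UNIV"
  shows "(\<lambda>n. infsum f (S n)) \<longlonglongrightarrow> infsum f UNIV"
proof (rule tendstoI)
  fix e :: real assume e: "0 < e"
  let ?g = "\<lambda>x. norm (f x)"
  have fs: "f summable_on UNIV" using f by (rule Infinite_Sum.abs_summable_summable)
  obtain F where F: "finite F" "dist (sum ?g F) (infsum ?g UNIV) \<le> e / 2"
    using infsum_finite_approximation[OF f, of "e / 2"] e by auto
  have "eventually (\<lambda>n. \<forall>x\<in>F. x \<in> S n) sequentially"
  proof (rule eventually_ball_finite[OF F(1)], rule ballI)
    fix x
    obtain n0 where "x \<in> S n0" using S(2) by blast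
    thus "eventually (\<lambda>n. x \<in> S n) sequentially"
      using S(1) by (auto simp: eventually_sequentially incseq_def intro!: exI[of _ n0])
  qed
  thus "eventually (\<lambda>n. dist (infsum f (S n)) (infsum f UNIV) < e) sequentially"
  proof eventually_elim
    case (elim n)
    have "infsum f (UNIV - S n) = infsum f UNIV - infsum f (S n)"
      by (rule infsum_Diff) (auto intro: summable_on_subset_banach[OF fs] fs)
    hence "dist (infsum f (S n)) (infsum f UNIV) = norm (infsum f (UNIV - S n))"
      by (simp add: dist_norm norm_minus_commute)
    also have "\<dots> \<le> infsum ?g (UNIV - S n)"
      by (rule norm_infsum_bound) (rule summable_on_subset_banach[OF f], simp)
    also have "\<dots> \<le> infsum ?g (UNIV - F)"
      by (rule infsum_mono2) (use elim in \<open>auto intro: summable_on_subset_banach[OF f]\<close>)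
    also have "\<dots> = infsum ?g UNIV - infsum ?g F"
      by (rule infsum_Diff) (auto intro: summable_on_subset_banach[OF f] f)
    also have "\<dots> \<le> e / 2" using F by (simp add: dist_real_def del: le_divide_eq_numeral1)
    also have "\<dots> < e" using e by simp
    finally show ?case .
  qed
qed

lemma bij_betw_mset_insert:
  assumes "k \<notin> K"
  shows "bij_betw (\<lambda>(j, B). replicate_mset j k + B)
           ((UNIV :: nat set) \<times> {B. set_mset B \<subseteq> K}) {A. set_mset A \<subseteq> insert k K}"
proof (rule bij_betwI')
  fix x y :: "nat \<times> 'a multiset"
  assume x: "x \<in> UNIV \<times> {B. set_mset B \<subseteq> K}" and y: "y \<in> UNIV \<times> {B. set_mset B \<subseteq> K}"
  obtain i A j B where xy: "x = (i, A)" "y = (j, B)" by (metis surj_pair)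
  have 0: "count A k = 0" "count B k = 0"
    using x y assms by (auto simp: xy count_eq_zero_iff)
  have "x = y" if eq: "replicate_mset i k + A = replicate_mset j k + B"
  proof -
    have "i = j" using arg_cong[OF eq, of "\<lambda>X. count X k"] 0 by simp
    thus ?thesis using eq by (simp add: xy)
  qed
  thus "((case x of (j, B) \<Rightarrow> replicate_mset j k + B) = (case y of (j, B) \<Rightarrow> replicate_mset j k + B)) \<longleftrightarrow> x = y"
    by (auto simp: xy)
next
  fix x :: "nat \<times> 'a multiset"
  assume "x \<in> UNIV \<times> {B. set_mset B \<subseteq> K}"
  thus "(case x of (j, B) \<Rightarrow> replicate_mset j k + B) \<in> {A. set_mset A \<subseteq> insert k K}"
    by (auto split: if_splits)
next
  fix A assume A: "A \<in> {A. set_mset A \<subseteq> insert k K}"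
  have "A = replicate_mset (count A k) k + filter_mset (\<lambda>i. i \<noteq> k) A"
    by (rule multiset_eqI) simp
  thus "\<exists>x\<in>UNIV \<times> {B. set_mset B \<subseteq> K}. A = (case x of (j, B) \<Rightarrow> replicate_mset j k + B)"
    using A by (intro bexI[of _ "(count A k, filter_mset (\<lambda>i. i \<noteq> k) A)"]) auto
qed

lemma euler_product_finite:
  fixes z :: "nat \<Rightarrow> complex"
  assumes f: "(\<lambda>A. norm (\<Prod>k\<in>#A. z k)) summable_on UNIV"
    and z: "\<And>k. norm (z k) < 1" and K: "finite K"
  shows "(\<Sum>\<^sub>\<infinity>A | set_mset A \<subseteq> K. \<Prod>k\<in>#A. z k) = (\<Prod>k\<in>K. 1 / (1 - z k))"
  using K
proof (induction K rule: finite_induct)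
  case empty
  have "{A :: nat multiset. set_mset A \<subseteq> {}} = {{#}}" by auto
  thus ?case by simp
next
  case (insert k K)
  let ?f = "\<lambda>A. \<Prod>k\<in>#A. z k"
  note bij = bij_betw_mset_insert[OF insert(2)]
  have fs: "?f summable_on X" for X
    by (rule summable_on_subset_banach[OF Infinite_Sum.abs_summable_summable[OF f]]) simp
  have eq: "?f (case x of (j, B) \<Rightarrow> replicate_mset j k + B) = (case x of (j, B) \<Rightarrow> z k ^ j * ?f B)" for x
    by (cases x) simp
  have sm: "(\<lambda>(j, B). z k ^ j * ?f B) summable_on UNIV \<times> {B. set_mset B \<subseteq> K}"
    using fs[of "{A. set_mset A \<subseteq> insert k K}"]
    unfolding summable_on_reindex_bij_betw[OF bij, symmetric] eq .
  have "(\<Sum>\<^sub>\<infinity>A | set_mset A \<subseteq> insert k K. ?f A) = (\<Sum>\<^sub>\<infinity>(j, B)\<in>UNIV \<times> {B. set_mset B \<subseteq> K}. z k ^ j * ?f B)"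
    unfolding infsum_reindex_bij_betw[OF bij, symmetric] eq ..
  also have "\<dots> = (\<Sum>\<^sub>\<infinity>j. \<Sum>\<^sub>\<infinity>B | set_mset B \<subseteq> K. z k ^ j * ?f B)"
    by (rule infsum_Sigma'_banach[symmetric]) (use sm in simp)
  also have "\<dots> = (\<Sum>\<^sub>\<infinity>j. z k ^ j) * (\<Sum>\<^sub>\<infinity>B | set_mset B \<subseteq> K. ?f B)"
    by (simp add: infsum_cmult_right' infsum_cmult_left')
  also have "(\<Sum>\<^sub>\<infinity>j. z k ^ j) = 1 / (1 - z k)"
  proof (rule infsumI, rule norm_summable_imp_has_sum)
    show "summable (\<lambda>j. norm (z k ^ j))"
      using z[of k] by (simp add: norm_power summable_geometric)
    show "(\<lambda>j. z k ^ j) sums (1 / (1 - z k))" by (rule geometric_sums[OF z])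
  qed
  finally show ?case using insert by simp
qed

lemma euler_product_exp:
  fixes z :: "nat \<Rightarrow> complex"
  assumes f: "(\<lambda>A. norm (\<Prod>k\<in>#A. z k)) summable_on UNIV" and z: "\<And>k. norm (z k) < 1"
  shows "(\<lambda>(j, k). norm (z k ^ Suc j / of_nat (Suc j))) summable_on UNIV"
    and "(\<Sum>\<^sub>\<infinity>A. \<Prod>k\<in>#A. z k) = exp (\<Sum>\<^sub>\<infinity>(j, k). z k ^ Suc j / of_nat (Suc j))"
proof -
  let ?f = "\<lambda>A. \<Prod>k\<in>#A. z k"
  let ?g = "\<lambda>(j, k). z k ^ Suc j / of_nat (Suc j)"
  let ?r = "\<lambda>(j, k :: nat). replicate_mset (Suc j) k"
  have inj: "inj ?r"
  proof (rule injI)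
    fix x y :: "nat \<times> nat" assume xy: "?r x = ?r y"
    obtain j k j' k' where x: "x = (j, k)" and y: "y = (j', k')" by (metis surj_pair)
    have eq: "replicate_mset (Suc j) k = replicate_mset (Suc j') k'" using xy by (simp add: x y)
    hence "size (replicate_mset (Suc j) k) = size (replicate_mset (Suc j') k')"
      and "set_mset (replicate_mset (Suc j) k) = set_mset (replicate_mset (Suc j') k')"
      by (simp_all only:)
    thus "x = y" by (simp add: x y split: if_splits)
  qed
  have "(\<lambda>A. norm (?f A)) summable_on range ?r"
    by (rule summable_on_subset_banach[OF f]) simp
  hence r: "((\<lambda>A. norm (?f A)) \<circ> ?r) summable_on UNIV"
    by (subst (asm) summable_on_reindex[OF inj])
  have g: "(\<lambda>x. norm (?g x)) summable_on UNIV"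
  proof (rule Infinite_Sum.abs_summable_on_comparison_test'[OF r])
    fix x :: "nat \<times> nat"
    obtain j k where x: "x = (j, k)" by fastforce
    have "norm (z k ^ Suc j) / real (Suc j) \<le> norm (z k ^ Suc j) / 1"
      by (rule divide_left_mono) auto
    thus "norm (?g x) \<le> ((\<lambda>A. norm (?f A)) \<circ> ?r) x"
      by (simp add: x norm_divide norm_mult norm_power del: of_nat_Suc)
  qed
  thus "(\<lambda>(j, k). norm (z k ^ Suc j / of_nat (Suc j))) summable_on UNIV"
    by (simp add: case_prod_unfold)
  have gs: "?g summable_on UNIV" using g by (rule Infinite_Sum.abs_summable_summable)

  have lim1: "(\<lambda>n. infsum ?f {A. set_mset A \<subseteq> {..<n}}) \<longlonglongrightarrow> infsum ?f UNIV"
  proof (rule tendsto_infsum_exhaust[OF f])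
    show "incseq (\<lambda>n. {A. set_mset A \<subseteq> {..<n}})"
      by (auto simp: incseq_def subset_iff intro: less_le_trans)
    have "\<exists>n. set_mset A \<subseteq> {..<n}" for A :: "nat multiset"
      using finite_nat_bounded[of "set_mset A"] by simp
    thus "(\<Union>n. {A :: nat multiset. set_mset A \<subseteq> {..<n}}) = UNIV" by (simp add: set_eq_iff)
  qed
  have lim2: "(\<lambda>n. exp (infsum ?g (UNIV \<times> {..<n}))) \<longlonglongrightarrow> exp (infsum ?g UNIV)"
  proof (rule tendsto_exp, rule tendsto_infsum_exhaust[OF g])
    show "incseq (\<lambda>n. (UNIV :: nat set) \<times> {..<n::nat})" by (auto simp: incseq_def)
    show "(\<Union>n. (UNIV :: nat set) \<times> {..<n::nat}) = UNIV"
      by (simp add: set_eq_iff) (meson lessI)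
  qed
  have ln: "(\<Sum>\<^sub>\<infinity>j. z k ^ Suc j / of_nat (Suc j)) = - ln (1 - z k)" for k
  proof (rule infsumI, rule norm_summable_imp_has_sum)
    have "(\<lambda>n. - (z k ^ n) / of_nat n) sums ln (1 - z k)"
      using Ln_series'[of "- z k"] z[of k] by simp
    hence "(\<lambda>n. - (z k ^ Suc n) / of_nat (Suc n)) sums ln (1 - z k)"
      by (subst sums_Suc_iff) simp
    from sums_minus[OF this] show "(\<lambda>j. z k ^ Suc j / of_nat (Suc j)) sums (- ln (1 - z k))" by simp
    show "summable (\<lambda>j. norm (z k ^ Suc j / of_nat (Suc j)))"
    proof (rule summable_comparison_test[OF _ summable_geometric[of "norm (z k)"]])
      have "norm (z k) ^ Suc n / real (Suc n) \<le> norm (z k) ^ n / 1" for n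
        using z[of k] by (intro frac_le) (auto simp: mult_left_le_one_le)
      thus "\<exists>N. \<forall>n\<ge>N. norm (norm (z k ^ Suc n / of_nat (Suc n))) \<le> norm (z k) ^ n"
        by (auto simp: norm_divide norm_power norm_mult simp del: of_nat_Suc)
    qed (use z in simp)
  qed
  have "exp (infsum ?g (UNIV \<times> {..<n})) = infsum ?f {A. set_mset A \<subseteq> {..<n}}" for n
  proof -
    have bij: "bij_betw prod.swap ({..<n} \<times> UNIV) ((UNIV :: nat set) \<times> {..<n})"
      by (auto simp: bij_betw_def inj_on_def image_iff)
    have sw: "(\<lambda>(k, j). z k ^ Suc j / of_nat (Suc j)) summable_on ({..<n} \<times> UNIV)"
      using summable_on_subset_banach[OF gs, of "UNIV \<times> {..<n}"]
      unfolding summable_on_reindex_bij_betw[OF bij, symmetric] by (simp add: case_prod_unfold)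
    have "infsum ?g (UNIV \<times> {..<n}) = (\<Sum>\<^sub>\<infinity>(k, j)\<in>{..<n} \<times> UNIV. z k ^ Suc j / of_nat (Suc j))"
      unfolding infsum_reindex_bij_betw[OF bij, symmetric] by (simp add: case_prod_unfold)
    also have "\<dots> = (\<Sum>\<^sub>\<infinity>k\<in>{..<n}. \<Sum>\<^sub>\<infinity>j. z k ^ Suc j / of_nat (Suc j))"
      by (rule infsum_Sigma'_banach[symmetric]) (use sw in simp)
    also have "\<dots> = (\<Sum>k<n. - ln (1 - z k))" unfolding ln by simp
    finally have "exp (infsum ?g (UNIV \<times> {..<n})) = (\<Prod>k<n. exp (- ln (1 - z k)))"
      by (simp add: exp_sum)
    also have "\<dots> = (\<Prod>k<n. 1 / (1 - z k))"
    proof (rule prod.cong)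
      fix k
      have "1 - z k \<noteq> 0" using z[of k] by auto
      thus "exp (- ln (1 - z k)) = 1 / (1 - z k)" by (simp add: exp_minus inverse_eq_divide)
    qed simp
    also have "\<dots> = infsum ?f {A. set_mset A \<subseteq> {..<n}}"
      by (rule euler_product_finite[OF f z, symmetric]) simp
    finally show ?thesis .
  qed
  thus "infsum ?f UNIV = exp (infsum ?g UNIV)"
    using LIMSEQ_unique[OF lim1] lim2 by simp
qed

lemma beurling_int_powr:
  assumes "beurling_primes p"
  shows "complex_of_real (beurling_int p A) powr (-s) = (\<Prod>k\<in>#A. complex_of_real (p k) powr (-s))"
proof (induction A)
  case (add k A)
  have "0 \<le> p k" "0 \<le> beurling_int p A"
    using beurling_primes_gt_1[OF assms, of k] beurling_int_ge_1[OF assms, of A] by auto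
  thus ?case using add by (simp add: powr_times_real)
qed simp

lemma norm_beurling_int_powr:
  assumes "beurling_primes p"
  shows "norm (complex_of_real (beurling_int p A) powr (-s)) = beurling_int p A powr (- Re s)"
  using beurling_int_ge_1[OF assms, of A] by (subst norm_powr_real_powr) auto

lemma beurling_zeta_eq_infsum:
  assumes p: "beurling_primes p"
    and s: "(\<lambda>A. beurling_int p A powr (- Re s)) summable_on UNIV"
  shows "beurling_zeta p s = (\<Sum>\<^sub>\<infinity>A. complex_of_real (beurling_int p A) powr (-s))"
  unfolding beurling_zeta_def beurling_N_eq_sum
  by (subst LINT_discrete)
     (use s in \<open>auto simp: finite_beurling_int_le[OF p] beurling_int_ge_1[OF p] norm_beurling_int_powr[OF p] intro!: continuous_intros\<close>)

lemma beurling_zeta_eq_exp: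
  assumes p: "beurling_primes p" and s0: "0 < Re s"
    and s: "(\<lambda>A. beurling_int p A powr (- Re s)) summable_on UNIV"
  shows "beurling_zeta p s =
    exp (LINT x:{1..}|interval_measure (beurling_Pi p). complex_of_real x powr (-s))"
proof -
  define z where "z = (\<lambda>k. complex_of_real (p k) powr (-s))"
  have z: "norm (z k) < 1" for k
  proof -
    have "norm (z k) = p k powr (- Re s)"
      unfolding z_def using beurling_primes_gt_1[OF p, of k] by (subst norm_powr_real_powr) auto
    also have "\<dots> < 1" using beurling_primes_gt_1[OF p, of k] s0 by (simp add: powr_less_one)
    finally show ?thesis .
  qed
  have prodz: "complex_of_real (beurling_int p A) powr (-s) = (\<Prod>k\<in>#A. z k)" for A
    unfolding z_def by (rule beurling_int_powr[OF p])
  have sm: "(\<lambda>A. norm (\<Prod>k\<in>#A. z k)) summable_on UNIV"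
    using s unfolding prodz[symmetric] norm_beurling_int_powr[OF p] .
  have pw: "complex_of_real (p k ^ Suc j) powr (-s) = z k ^ Suc j" for j k
    using prodz[of "replicate_mset (Suc j) k"] by (simp add: beurling_int_def)
  have Pi: "beurling_Pi p = (\<lambda>x. \<Sum>i | (case i of (j, k) \<Rightarrow> p k ^ Suc j) \<le> x. case i of (j, k) \<Rightarrow> 1 / real (Suc j))"
    unfolding beurling_Pi_eq_sum[OF p] by (intro ext sum.cong) auto
  have "(LINT x:{1..}|interval_measure (beurling_Pi p). complex_of_real x powr (-s)) =
      (\<Sum>\<^sub>\<infinity>i. complex_of_real (case i of (j, k) \<Rightarrow> 1 / real (Suc j)) *
         (complex_of_real (case i of (j, k) \<Rightarrow> p k ^ Suc j) powr (-s)))"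
    unfolding Pi
  proof (rule LINT_discrete)
    show "finite {i. (case i of (j, k) \<Rightarrow> p k ^ Suc j) \<le> x}" for x
      using finite_beurling_prime_powers_le[OF p, of x] by (simp add: case_prod_unfold)
    show "0 \<le> (case i of (j, k) \<Rightarrow> 1 / real (Suc j))" for i :: "nat \<times> nat"
      by (auto split: prod.split)
    show "1 \<le> (case i of (j, k) \<Rightarrow> p k ^ Suc j)" for i
      using beurling_primes_gt_1[OF p] by (auto split: prod.split intro!: one_le_power less_imp_le simp del: power_Suc)
    show "(\<lambda>i. (case i of (j, k) \<Rightarrow> 1 / real (Suc j)) *
        norm (complex_of_real (case i of (j, k) \<Rightarrow> p k ^ Suc j) powr (-s))) summable_on UNIV"
      using euler_product_exp(1)[OF sm z]
      by (rule back_subst[where P = "\<lambda>h. h summable_on UNIV"])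
         (auto simp: fun_eq_iff pw norm_divide simp del: power_Suc of_nat_Suc of_real_power)
  qed (auto intro!: continuous_intros)
  also have "\<dots> = (\<Sum>\<^sub>\<infinity>(j, k). z k ^ Suc j / of_nat (Suc j))"
    by (intro infsum_cong) (auto simp: pw simp del: power_Suc of_nat_Suc of_real_power)
  finally show ?thesis
    using euler_product_exp(2)[OF sm z] by (simp add: beurling_zeta_eq_infsum[OF p s] prodz)
qed

lemma beurling_zeta_mu:
  assumes p: "beurling_primes p"
    and s: "(\<lambda>A. beurling_int p A powr (- Re s)) summable_on UNIV"
  shows "(\<Sum>\<^sub>\<infinity>A. of_real (beurling_mu A) * complex_of_real (beurling_int p A) powr (-s)) * beurling_zeta p s = 1"
proof -
  define f where "f = (\<lambda>A. complex_of_real (beurling_int p A) powr (-s))"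
  define g where "g = (\<lambda>A. of_real (beurling_mu A) * f A)"
  have f: "(\<lambda>A. norm (f A)) summable_on UNIV"
    using s unfolding f_def norm_beurling_int_powr[OF p] .
  have g: "(\<lambda>A. norm (g A)) summable_on UNIV"
    by (rule Infinite_Sum.abs_summable_on_comparison_test'[OF f])
       (auto simp: g_def norm_mult beurling_mu_def)
  have fplus: "f (A + B) = f A * f B" for A B
    unfolding f_def by (simp add: beurling_int_powr[OF p] flip: beurling_int_plus)
  have sm: "(\<lambda>(A, B). g A * f B) summable_on UNIV \<times> UNIV"
  proof (rule Infinite_Sum.abs_summable_summable)
    have "(\<lambda>(A, B). norm (g A) * norm (f B)) summable_on UNIV \<times> UNIV"
    proof (rule summable_on_SigmaI)
      show "((\<lambda>B. case (A, B) of (A, B) \<Rightarrow> norm (g A) * norm (f B)) has_sum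
              norm (g A) * infsum (\<lambda>B. norm (f B)) UNIV) UNIV" for A
        using has_sum_cmult_right[OF has_sum_infsum[OF f]] by simp
      show "(\<lambda>A. norm (g A) * infsum (\<lambda>B. norm (f B)) UNIV) summable_on UNIV"
        by (rule summable_on_cmult_left[OF g])
    qed auto
    thus "(\<lambda>x. norm (case x of (A, B) \<Rightarrow> g A * f B)) summable_on UNIV \<times> UNIV"
      by (simp add: case_prod_unfold norm_mult)
  qed
  have bij: "bij_betw (\<lambda>(C, A). (A, C - A)) (Sigma UNIV (\<lambda>C. {A. A \<subseteq># C})) (UNIV \<times> UNIV)"
    by (rule bij_betw_byWitness[where f' = "\<lambda>(A, B). (A + B, A)"])
       (auto simp: subset_mset.add_diff_inverse)
  have eq: "(case (case x of (C, A) \<Rightarrow> (A, C - A)) of (A, B) \<Rightarrow> g A * f B) =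
      (case x of (C, A) \<Rightarrow> of_real (beurling_mu A) * f C)"
    if "x \<in> Sigma UNIV (\<lambda>C. {A. A \<subseteq># C})" for x
    using that by (auto simp: g_def mult.assoc subset_mset.add_diff_inverse simp flip: fplus)
  have sm': "(\<lambda>(C, A). of_real (beurling_mu A) * f C) summable_on Sigma UNIV (\<lambda>C. {A. A \<subseteq># C})"
    using sm unfolding summable_on_reindex_bij_betw[OF bij, symmetric]
    by (subst (asm) summable_on_cong[OF eq])
  have fin: "finite {B. B \<subseteq># A}" for A :: "nat multiset"
  proof -
    have "{B. B \<subseteq># A} \<subseteq> (\<Union>n\<in>{..size A}. multisets_of_size (set_mset A) n)"
      by (auto simp: multisets_of_size_def size_mset_mono dest: mset_subset_eqD)
    thus ?thesis by (rule finite_subset) auto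
  qed
  have "infsum g UNIV * infsum f UNIV = (\<Sum>\<^sub>\<infinity>A. \<Sum>\<^sub>\<infinity>B. g A * f B)"
    by (simp add: infsum_cmult_right' infsum_cmult_left')
  also have "\<dots> = (\<Sum>\<^sub>\<infinity>(A, B)\<in>UNIV \<times> UNIV. g A * f B)"
    by (rule infsum_Sigma'_banach) (use sm in simp)
  also have "\<dots> = (\<Sum>\<^sub>\<infinity>(C, A)\<in>Sigma UNIV (\<lambda>C. {A. A \<subseteq># C}). of_real (beurling_mu A) * f C)"
    unfolding infsum_reindex_bij_betw[OF bij, symmetric] by (rule infsum_cong[OF eq])
  also have "\<dots> = (\<Sum>\<^sub>\<infinity>C. \<Sum>\<^sub>\<infinity>A | A \<subseteq># C. of_real (beurling_mu A) * f C)"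
    by (rule infsum_Sigma'_banach[symmetric]) (rule sm')
  also have "\<dots> = (\<Sum>\<^sub>\<infinity>C. of_real (\<Sum>A | A \<subseteq># C. beurling_mu A) * f C)"
    by (intro infsum_cong) (simp add: fin sum_distrib_right)
  also have "\<dots> = (\<Sum>\<^sub>\<infinity>C\<in>{{#}}. f C)"
    unfolding beurling_mu_convolution by (rule infsum_cong_neutral) auto
  also have "\<dots> = 1" by (simp add: f_def)
  finally show ?thesis
    unfolding g_def f_def beurling_zeta_eq_infsum[OF p s] .
qed

lemma beurling_int_powr_summable:
  assumes p: "beurling_primes p" and N: "beurling_N p \<sim>[at_top] (\<lambda>x. a * x)" and \<sigma>: "1 < \<sigma>"
  shows "(\<lambda>A. beurling_int p A powr (-\<sigma>)) summable_on UNIV"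
proof -
  have "beurling_N p \<in> O(\<lambda>x. a * x)" by (rule asymp_equiv_imp_bigo[OF N])
  also have "(\<lambda>x. a * x) \<in> O(\<lambda>x. x)" by simp
  finally obtain c where "eventually (\<lambda>x. norm (beurling_N p x) \<le> c * norm x) at_top"
    by (rule landau_o.bigE)
  then obtain X where X: "\<And>x. X \<le> x \<Longrightarrow> norm (beurling_N p x) \<le> c * norm x"
    by (auto simp: eventually_at_top_linorder)
  have mono: "beurling_N p x \<le> beurling_N p y" if "x \<le> y" for x y
    unfolding beurling_N_def using that
    by (intro of_nat_mono card_mono finite_beurling_int_le[OF p]) auto
  define C where "C = max \<bar>c\<bar> (beurling_N p X)"
  have C: "beurling_N p x \<le> C * x" if "1 \<le> x" for x
  proof (cases "X \<le> x")
    case True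
    have "beurling_N p x \<le> c * x" using X[OF True] that by (simp add: beurling_N_def)
    also have "\<dots> \<le> C * x" using that by (intro mult_right_mono) (auto simp: C_def)
    finally show ?thesis .
  next
    case False
    have "beurling_N p x \<le> C * 1" using mono[of x X] False by (auto simp: C_def)
    also have "\<dots> \<le> C * x" using that by (intro mult_left_mono) (auto simp: C_def)
    finally show ?thesis .
  qed
  let ?n = "beurling_int p"
  define lev where "lev = (\<lambda>A. nat \<lfloor>log 2 (?n A)\<rfloor>)"
  have lev: "2 ^ lev A \<le> ?n A" "?n A \<le> 2 ^ Suc (lev A)" for A
  proof -
    have n: "1 \<le> ?n A" by (rule beurling_int_ge_1[OF p])
    hence l: "real (lev A) = of_int \<lfloor>log 2 (?n A)\<rfloor>" by (simp add: lev_def)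
    have "2 powr real (lev A) \<le> 2 powr log 2 (?n A)" unfolding l by simp
    thus "2 ^ lev A \<le> ?n A" using n by (simp add: powr_realpow)
    have "2 powr log 2 (?n A) \<le> 2 powr real (Suc (lev A))"
      using l by (intro powr_mono) (simp_all, linarith)
    thus "?n A \<le> 2 ^ Suc (lev A)" using n by (simp add: powr_realpow del: of_nat_Suc power_Suc)
  qed
  define q where "q = 2 powr (1 - \<sigma>)"
  have q: "0 \<le> q" "q < 1" using \<sigma> by (auto simp: q_def powr_less_one)
  show ?thesis
  proof (rule nonneg_bdd_above_summable_on, simp, rule bdd_aboveI2)
    fix F :: "nat multiset set" assume "F \<in> {F. F \<subseteq> UNIV \<and> finite F}"
    hence F: "finite F" by simp
    have "(\<Sum>A\<in>F. ?n A powr (-\<sigma>)) = (\<Sum>l\<in>lev ` F. \<Sum>A | A \<in> F \<and> lev A = l. ?n A powr (-\<sigma>))"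
      by (rule sum.image_gen[OF F])
    also have "\<dots> \<le> (\<Sum>l\<in>lev ` F. 2 * C * q ^ l)"
    proof (rule sum_mono)
      fix l
      have "(\<Sum>A | A \<in> F \<and> lev A = l. ?n A powr (-\<sigma>)) \<le> (\<Sum>A | A \<in> F \<and> lev A = l. (2 ^ l) powr (-\<sigma>))"
        by (intro sum_mono powr_mono2') (use lev(1) \<sigma> in auto)
      also have "\<dots> = real (card {A \<in> F. lev A = l}) * (2 ^ l) powr (-\<sigma>)" by simp
      also have "\<dots> \<le> beurling_N p (2 ^ Suc l) * (2 ^ l) powr (-\<sigma>)"
        unfolding beurling_N_def
        by (intro mult_right_mono of_nat_mono card_mono finite_beurling_int_le[OF p])
           (use lev(2) in \<open>auto simp del: power_Suc\<close>)
      also have "\<dots> \<le> C * 2 ^ Suc l * (2 ^ l) powr (-\<sigma>)"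
        by (intro mult_right_mono C) (auto simp: one_le_power simp del: power_Suc)
      also have "\<dots> = 2 * C * (2 powr real l * 2 powr (- \<sigma> * real l))"
        by (simp add: powr_powr mult.commute flip: powr_realpow)
      also have "2 powr real l * 2 powr (- \<sigma> * real l) = 2 powr ((1 - \<sigma>) * real l)"
        by (simp add: algebra_simps flip: powr_add)
      also have "\<dots> = q ^ l" by (simp add: q_def powr_powr flip: powr_realpow)
      finally show "(\<Sum>A | A \<in> F \<and> lev A = l. ?n A powr (-\<sigma>)) \<le> 2 * C * q ^ l" .
    qed
    also have "\<dots> = 2 * C * (\<Sum>l\<in>lev ` F. q ^ l)" by (simp add: sum_distrib_left)
    also have "\<dots> \<le> 2 * C * (\<Sum>l. q ^ l)"
      by (intro mult_left_mono sum_le_suminf summable_geometric) (use F q in \<open>auto simp: C_def\<close>)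
    finally show "(\<Sum>A\<in>F. ?n A powr (-\<sigma>)) \<le> 2 * C * (\<Sum>l. q ^ l)" .
  qed
qed

lemma beurling_zeta_identities:
  assumes p: "beurling_primes p" and N: "beurling_N p \<sim>[at_top] (\<lambda>x. a * x)" and s: "1 < Re s"
  shows "beurling_zeta p s =
           exp (LINT x:{1..}|interval_measure (beurling_Pi p). complex_of_real x powr (-s))"
    and "(\<Sum>\<^sub>\<infinity>A. of_real (beurling_mu A) * complex_of_real (beurling_int p A) powr (-s)) =
           1 / beurling_zeta p s"
proof -
  note sm = beurling_int_powr_summable[OF p N s]
  show eq: "beurling_zeta p s =
      exp (LINT x:{1..}|interval_measure (beurling_Pi p). complex_of_real x powr (-s))"
    by (rule beurling_zeta_eq_exp[OF p _ sm]) (use s in simp)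
  hence "beurling_zeta p s \<noteq> 0" by simp
  thus "(\<Sum>\<^sub>\<infinity>A. of_real (beurling_mu A) * complex_of_real (beurling_int p A) powr (-s)) =
      1 / beurling_zeta p s"
    using beurling_zeta_mu[OF p sm] by (simp add: eq_divide_eq)
qed

end

theory Submission
  imports Defs "HOL-Probability.Sinc_Integral"
begin

text \<open>
  Put \<open>f(u) = m(e\<^sup>u)\<close>. Its Laplace transform is \<open>G(s) = 1 / (s \<zeta>(1 + s))\<close>, and the hypothesis says
  that \<open>G(\<epsilon> + it)\<close> is, locally in \<open>t\<close> and uniformly in \<open>\<epsilon>\<close>, dominated by a constant multiple of
  \<open>\<Prod> |t - t\<^sub>n| powr (- max \<beta>\<^sub>n 0)\<close>, which is locally integrable because every \<open>\<beta>\<^sub>n < 1\<close>.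
  No boundary value of \<open>G\<close> need exist, but the domination alone yields a Riemann--Lebesgue lemma, so
  the convolution of \<open>f\<close> with a kernel whose Fourier transform has compact support tends to \<open>0\<close>
  along every sufficiently fine arithmetic progression. Since \<open>N(x) \<sim> ax\<close> makes \<open>f\<close> slowly
  oscillating, and hence of at most linear growth, the kernel can be concentrated and removed, and
  \<open>f \<rightarrow> 0\<close>.
\<close>

subsection \<open>Fourier transforms and convolutions\<close>

lemma borel_measurable_cis [measurable]: "cis \<in> borel_measurable borel"
  by (intro borel_measurable_continuous_onI continuous_intros)

definition fourier :: "(real \<Rightarrow> complex) \<Rightarrow> real \<Rightarrow> complex" where
  "fourier f v = (LINT t|lborel. f t * cis (t * v))"

definition convolve :: "(real \<Rightarrow> complex) \<Rightarrow> (real \<Rightarrow> complex) \<Rightarrow> real \<Rightarrow> complex" where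
  "convolve f g t = (LINT s|lborel. f s * g (t - s))"

lemma borel_measurable_fourier [measurable]:
  assumes [measurable]: "f \<in> borel_measurable borel"
  shows "fourier f \<in> borel_measurable borel"
  unfolding fourier_def[abs_def] by measurable

lemma borel_measurable_convolve [measurable]:
  assumes [measurable]: "f \<in> borel_measurable borel" "g \<in> borel_measurable borel"
  shows "convolve f g \<in> borel_measurable borel"
  unfolding convolve_def[abs_def] by measurable

lemma integrable_mult_cis:
  fixes f :: "real \<Rightarrow> complex"
  assumes "integrable lborel f"
  shows "integrable lborel (\<lambda>t. f t * cis (t * v))"
  by (rule Bochner_Integration.integrable_bound[OF assms])
     (use borel_measurable_integrable[OF assms] in \<open>auto simp: norm_mult\<close>)

lemma fourier_diff:
  assumes "integrable lborel f" "integrable lborel g"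
  shows "fourier (\<lambda>t. f t - g t) v = fourier f v - fourier g v"
  unfolding fourier_def left_diff_distrib
  by (intro Bochner_Integration.integral_diff integrable_mult_cis assms)

lemma norm_fourier_le: "norm (fourier f v) \<le> (LINT t|lborel. norm (f t))"
  unfolding fourier_def
  by (rule order_trans[OF integral_norm_bound]) (simp add: norm_mult)

lemma fourier_rescale:
  assumes "0 < \<rho>"
  shows "fourier (\<lambda>t. f (t / \<rho>)) v = of_real \<rho> * fourier f (\<rho> * v)"
  unfolding fourier_def
  by (subst lborel_integral_real_affine[where c = \<rho> and t = 0])
     (use assms in \<open>auto simp: mult_ac scaleR_conv_of_real\<close>)

lemma integrable_convolve_integrand:
  fixes f g :: "real \<Rightarrow> complex"
  assumes f: "integrable lborel f" and g: "integrable lborel g"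
  shows "integrable (lborel \<Otimes>\<^sub>M lborel) (\<lambda>(s, t). f s * g (t - s))"
proof (rule lborel_pair.Fubini_integrable)
  note [measurable] = borel_measurable_integrable[OF f] borel_measurable_integrable[OF g]
  show "(\<lambda>(s, t). f s * g (t - s)) \<in> borel_measurable (lborel \<Otimes>\<^sub>M lborel)" by measurable
  have shift: "(LINT t|lborel. norm (g (t - s))) = (LINT t|lborel. norm (g t))" for s
    by (subst lborel_integral_real_affine[where c = 1 and t = s]) auto
  show "integrable lborel (\<lambda>s. LINT t|lborel. norm (case (s, t) of (s, t) \<Rightarrow> f s * g (t - s)))"
    using integrable_norm[OF f] by (simp add: norm_mult shift)
  show "AE s in lborel. integrable lborel (\<lambda>t. case (s, t) of (s, t) \<Rightarrow> f s * g (t - s))"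
  proof (intro AE_I2)
    show "integrable lborel (\<lambda>t. case (s, t) of (s, t) \<Rightarrow> f s * g (t - s))" for s
      using lborel_integrable_real_affine[OF g, of 1 "- s"] by simp
  qed
qed

lemma integrable_convolve:
  assumes "integrable lborel f" "integrable lborel g"
  shows "integrable lborel (convolve f g)"
  using lborel_pair.integrable_snd[OF integrable_convolve_integrand[OF assms]]
  unfolding convolve_def[abs_def] .

lemma fourier_convolve:
  assumes f: "integrable lborel f" and g: "integrable lborel g"
  shows "fourier (convolve f g) v = fourier f v * fourier g v"
proof -
  note [measurable] = borel_measurable_integrable[OF f] borel_measurable_integrable[OF g]
  have int: "integrable (lborel \<Otimes>\<^sub>M lborel) (\<lambda>(s, t). f s * g (t - s) * cis (t * v))"
    by (rule Bochner_Integration.integrable_bound[OF integrable_convolve_integrand[OF f g]])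
       (auto simp: norm_mult)
  have shift: "(LINT t|lborel. g (t - s) * cis (t * v)) = cis (s * v) * fourier g v" for s
    unfolding fourier_def
    by (subst lborel_integral_real_affine[where c = 1 and t = s])
       (auto simp: distrib_right simp flip: cis_mult integral_mult_right_zero
             intro!: Bochner_Integration.integral_cong)
  have "fourier (convolve f g) v = (LINT t|lborel. LINT s|lborel. f s * g (t - s) * cis (t * v))"
    by (simp add: fourier_def convolve_def)
  also have "\<dots> = (LINT s|lborel. LINT t|lborel. f s * g (t - s) * cis (t * v))"
    by (rule lborel_pair.Fubini_integral[OF int])
  also have "\<dots> = (LINT s|lborel. f s * cis (s * v) * fourier g v)"
    by (simp add: mult.assoc shift)
  finally show ?thesis by (simp add: fourier_def)
qed

lemma fourier_multiplication_formula:
  assumes f: "integrable lborel f" and g: "integrable lborel g"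
  shows "fourier (\<lambda>t. f t * fourier g (- t)) h = (LINT u|lborel. g u * fourier f (h - u))"
proof -
  note [measurable] = borel_measurable_integrable[OF f] borel_measurable_integrable[OF g]
  have int: "integrable (lborel \<Otimes>\<^sub>M lborel) (\<lambda>(t, u). f t * g u * cis (t * (h - u)))"
  proof (rule lborel_pair.Fubini_integrable)
    show "integrable lborel
        (\<lambda>t. LINT u|lborel. norm (case (t, u) of (t, u) \<Rightarrow> f t * g u * cis (t * (h - u))))"
      using integrable_norm[OF f] by (simp add: norm_mult)
    show "AE t in lborel. integrable lborel (\<lambda>u. case (t, u) of (t, u) \<Rightarrow> f t * g u * cis (t * (h - u)))"
      by (intro AE_I2 Bochner_Integration.integrable_bound[OF integrable_mult_right[OF g]])
         (auto simp: norm_mult)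
  qed measurable
  have "f t * fourier g (- t) * cis (t * h) = (LINT u|lborel. f t * g u * cis (t * (h - u)))" for t
  proof -
    have "(\<lambda>u. f t * g u * cis (t * (h - u))) = (\<lambda>u. f t * cis (t * h) * (g u * cis (u * (- t))))"
      by (simp add: fun_eq_iff mult_ac cis_mult right_diff_distrib)
    thus ?thesis by (simp add: fourier_def)
  qed
  hence "fourier (\<lambda>t. f t * fourier g (- t)) h =
      (LINT t|lborel. LINT u|lborel. f t * g u * cis (t * (h - u)))"
    by (simp add: fourier_def)
  also have "\<dots> = (LINT u|lborel. LINT t|lborel. f t * g u * cis (t * (h - u)))"
    by (rule lborel_pair.Fubini_integral[OF int, symmetric])
  also have "\<dots> = (LINT u|lborel. g u * fourier f (h - u))"
    by (simp add: fourier_def mult_ac flip: integral_mult_right_zero)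
  finally show ?thesis .
qed

subsection \<open>B-splines and the Jackson kernel\<close>

primrec bspline :: "nat \<Rightarrow> real \<Rightarrow> complex" where
  "bspline 0 = indicator {-1..1}"
| "bspline (Suc n) = convolve (indicator {-1..1}) (bspline n)"

text \<open>The exponent makes the kernel nonnegative and integrable against functions of linear growth; the
  support of its Fourier transform \<open>bspline 3\<close> is compact.\<close>

definition jackson :: "real \<Rightarrow> real" where
  "jackson v = (2 * sinc v) ^ 4"

definition jackson_mass :: real where
  "jackson_mass = (LINT v|lborel. jackson v)"

definition jackson_tail :: "real \<Rightarrow> real" where
  "jackson_tail V = (LINT v|lborel. (1 + \<bar>v\<bar>) * jackson v * indicator {v. V < \<bar>v\<bar>} v)"

lemma borel_measurable_bspline [measurable]: "bspline n \<in> borel_measurable borel"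
  by (induction n) auto

lemma integrable_bspline: "integrable lborel (bspline n)"
proof -
  have "integrable lborel (\<lambda>t. complex_of_real (indicat_real {-1..1::real} t))"
    by (intro integrable_of_real) simp
  hence "integrable lborel (indicator {-1..1} :: real \<Rightarrow> complex)"
    by (simp add: of_real_indicator)
  thus ?thesis by (induction n) (simp_all add: integrable_convolve)
qed

lemma bspline_eq_0: "real n + 1 < \<bar>t\<bar> \<Longrightarrow> bspline n t = 0"
proof (induction n arbitrary: t)
  case (Suc n)
  have "indicator {-1..1} s * bspline n (t - s) = 0" for s
    using Suc.IH[of "t - s"] Suc.prems by (auto simp: indicator_def)
  thus ?case by (simp only: bspline.simps convolve_def) simp
qed (auto simp: indicator_def)

lemma norm_bspline_le: "norm (bspline n t) \<le> 2 ^ n"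
proof (induction n arbitrary: t)
  case (Suc n)
  have "norm (bspline (Suc n) t) \<le> (LINT s|lborel. 2 ^ n * indicat_real {-1..1::real} s)"
    unfolding bspline.simps convolve_def
  proof (rule Bochner_Integration.integral_norm_bound_integral)
    show bound: "norm (indicator {-1..1} s * bspline n (t - s)) \<le> 2 ^ n * indicat_real {-1..1} s" for s
      using Suc.IH by (auto simp: indicator_def)
    show "integrable lborel (\<lambda>s::real. 2 ^ n * indicat_real {-1..1} s)" by simp
    thus "integrable lborel (\<lambda>s. indicator {-1..1} s * bspline n (t - s))"
      by (rule Bochner_Integration.integrable_bound) (use bound in \<open>auto intro: order_trans\<close>)
  qed
  thus ?case by simp
qed (auto simp: indicator_def)

lemma fourier_indicator: "fourier (indicator {-1..1}) v = of_real (2 * sinc v)"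
proof (cases "v = 0")
  case False
  have "(LINT t|lborel. indicat_real {-1..1} t *\<^sub>R cis (t * v)) =
      cis (1 * v) / (\<i> * v) - cis (- 1 * v) / (\<i> * v)"
  proof (rule integral_FTC_atLeastAtMost)
    show "((\<lambda>t. cis (t * v) / (\<i> * v)) has_vector_derivative cis (t * v)) (at t within {-1..1})" for t
      using False unfolding has_vector_derivative_def
      by (auto intro!: derivative_eq_intros simp: fun_eq_iff scaleR_conv_of_real)
         (simp add: complex_eq_iff)
  qed (auto intro!: continuous_intros)
  also have "\<dots> = of_real (2 * sinc v)"
    using False by (simp add: complex_eq_iff field_simps Re_divide Im_divide power2_eq_square)
  finally show ?thesis
    by (simp add: fourier_def scaleR_conv_of_real of_real_indicator del: of_real_mult)
next
  case True
  have "fourier (indicator {-1..1}) 0 = (LINT t|lborel. complex_of_real (indicat_real {-1..1::real} t))"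
    by (simp add: fourier_def of_real_indicator)
  also have "\<dots> = 2" by (subst integral_complex_of_real) simp
  finally show ?thesis using True by simp
qed

lemma fourier_bspline: "fourier (bspline n) v = of_real ((2 * sinc v) ^ Suc n)"
proof (induction n)
  case (Suc n)
  have "integrable lborel (indicator {-1..1} :: real \<Rightarrow> complex)"
    using integrable_bspline[of 0] by simp
  thus ?case
    by (simp add: fourier_convolve integrable_bspline Suc fourier_indicator)
qed (simp add: fourier_indicator)

lemma borel_measurable_jackson [measurable]: "jackson \<in> borel_measurable borel"
  unfolding jackson_def[abs_def] by measurable

lemma jackson_nonneg: "0 \<le> jackson v"
  by (simp add: jackson_def)

lemma jackson_le: "(1 + \<bar>v\<bar>) * jackson v \<le> 128 * inverse (1 + v\<^sup>2)"
proof -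
  have pos: "0 < 1 + v\<^sup>2" by (simp add: add_pos_nonneg)
  define r where "r = sinc v"
  have "r\<^sup>2 * (1 + v\<^sup>2) \<le> 2"
  proof (cases "v = 0")
    case False
    have "\<bar>sin v / v\<bar> \<le> 1" using abs_sin_x_le_abs_x[of v] False by simp
    hence "(sin v / v)\<^sup>2 + (sin v)\<^sup>2 \<le> 1 + 1" by (intro add_mono) (simp_all add: abs_square_le_1)
    thus ?thesis using False by (simp add: r_def distrib_left power_divide)
  qed (simp add: r_def)
  hence "(r\<^sup>2 * (1 + v\<^sup>2))\<^sup>2 \<le> 2\<^sup>2" using pos by (intro power_mono) auto
  hence le_64: "jackson v * (1 + v\<^sup>2)\<^sup>2 \<le> 64"
    by (simp add: jackson_def power_mult_distrib flip: power_mult r_def)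
  have "1 + \<bar>v\<bar> \<le> 2 * (1 + v\<^sup>2)"
  proof -
    have "2 * \<bar>v\<bar> \<le> v\<^sup>2 + 1"
      using zero_le_power2[of "\<bar>v\<bar> - 1"] by (simp add: power2_diff)
    thus ?thesis using zero_le_power2[of v] abs_ge_zero[of v] by argo
  qed
  hence "(1 + \<bar>v\<bar>) * (jackson v * (1 + v\<^sup>2)) \<le> 2 * (1 + v\<^sup>2) * (jackson v * (1 + v\<^sup>2))"
    using jackson_nonneg[of v] pos by (intro mult_right_mono) auto
  also have "\<dots> = 2 * (jackson v * (1 + v\<^sup>2)\<^sup>2)" by (simp only: power2_eq_square mult_ac)
  also have "\<dots> \<le> 128" using le_64 by simp
  finally show ?thesis using pos by (simp add: pos_le_divide_eq mult.assoc flip: divide_inverse)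
qed

lemma integrable_jackson_weighted: "integrable lborel (\<lambda>v. (1 + \<bar>v\<bar>) * jackson v)"
proof (rule Bochner_Integration.integrable_bound)
  show "integrable lborel (\<lambda>v::real. 128 * inverse (1 + v\<^sup>2))"
    using integrable_inverse_1_plus_square by (simp add: set_integrable_def)
  show "AE v in lborel. norm ((1 + \<bar>v\<bar>) * jackson v) \<le> norm (128 * inverse (1 + v\<^sup>2))"
    using jackson_le jackson_nonneg by (intro AE_I2) (auto simp: abs_mult)
qed auto

lemma integrable_jackson: "integrable lborel jackson"
proof (rule Bochner_Integration.integrable_bound[OF integrable_jackson_weighted])
  show "AE v in lborel. norm (jackson v) \<le> norm ((1 + \<bar>v\<bar>) * jackson v)"
    using jackson_nonneg by (intro AE_I2) (auto simp: abs_mult distrib_right)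
qed auto

lemma jackson_mass_pos: "0 < jackson_mass"
proof -
  have "\<not> (AE v in lborel. jackson v = 0)"
  proof
    assume "AE v in lborel. jackson v = 0"
    hence "AE v in lborel. v \<notin> {1<..<2::real}"
    proof eventually_elim
      case (elim v)
      have "0 < sin v" if "1 < v" "v < 2" using that pi_gt3 by (intro sin_gt_zero) auto
      thus ?case using elim by (auto simp: jackson_def split: if_splits)
    qed
    hence "{1<..<2::real} \<in> null_sets lborel" by (subst AE_iff_null_sets) auto
    thus False by (simp add: null_sets_def)
  qed
  hence "jackson_mass \<noteq> 0"
    using integral_nonneg_eq_0_iff_AE[OF integrable_jackson] jackson_nonneg
    by (simp add: jackson_mass_def)
  moreover have "0 \<le> jackson_mass"
    unfolding jackson_mass_def using jackson_nonneg by (intro integral_nonneg_AE) auto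
  ultimately show ?thesis by simp
qed

lemma fourier_bspline_mult_fourier:
  assumes F: "integrable lborel F" and \<rho>: "0 < \<rho>"
  shows "fourier (\<lambda>t. bspline 3 (t / \<rho>) * fourier (\<lambda>u. of_real (F u)) (- t)) h =
    of_real (LINT v|lborel. F (h - v / \<rho>) * jackson v)"
proof -
  have bspline: "integrable lborel (\<lambda>t. bspline 3 (t / \<rho>))"
    using lborel_integrable_real_affine[OF integrable_bspline[of 3], of "1 / \<rho>" 0] \<rho> by simp
  have kernel: "fourier (\<lambda>t. bspline 3 (t / \<rho>)) v = of_real (\<rho> * jackson (\<rho> * v))" for v
    unfolding fourier_rescale[OF \<rho>] fourier_bspline jackson_def
    by (simp only: of_real_mult Suc_numeral add_num_simps)
  have "fourier (\<lambda>t. bspline 3 (t / \<rho>) * fourier (\<lambda>u. of_real (F u)) (- t)) h =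
      (LINT u|lborel. complex_of_real (F u * (\<rho> * jackson (\<rho> * (h - u)))))"
    using fourier_multiplication_formula[OF bspline integrable_of_real[OF F], of h]
    unfolding kernel of_real_mult[symmetric] .
  also have "\<dots> = of_real (LINT u|lborel. F u * (\<rho> * jackson (\<rho> * (h - u))))"
    by (rule integral_complex_of_real)
  also have "(LINT u|lborel. F u * (\<rho> * jackson (\<rho> * (h - u)))) =
      (LINT v|lborel. F (h - v / \<rho>) * jackson v)"
    by (subst lborel_integral_real_affine[where c = "- (1 / \<rho>)" and t = h])
       (use \<rho> in \<open>auto simp: field_simps simp flip: integral_mult_right_zero\<close>)
  finally show ?thesis .
qed

subsection \<open>Bessel's inequality and a Riemann--Lebesgue lemma\<close>

definition square_integrable :: "'a measure \<Rightarrow> ('a \<Rightarrow> complex) \<Rightarrow> bool" where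
  "square_integrable M f \<longleftrightarrow> f \<in> borel_measurable M \<and> integrable M (\<lambda>x. (norm (f x))\<^sup>2)"

definition L2_inner :: "'a measure \<Rightarrow> ('a \<Rightarrow> complex) \<Rightarrow> ('a \<Rightarrow> complex) \<Rightarrow> complex" where
  "L2_inner M f g = (LINT x|M. f x * cnj (g x))"

lemma L2_inner_commute: "L2_inner M g f = cnj (L2_inner M f g)"
  unfolding L2_inner_def
  by (subst Bochner_Integration.integral_cnj[symmetric]) (simp add: mult.commute)

lemma L2_inner_self: "L2_inner M f f = of_real (LINT x|M. (norm (f x))\<^sup>2)"
  unfolding L2_inner_def
  by (subst integral_complex_of_real[symmetric]) (simp only: complex_norm_square)

lemma integrable_mult_cnj:
  assumes f: "square_integrable M f" and g: "square_integrable M g"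
  shows "integrable M (\<lambda>x. f x * cnj (g x))"
proof (rule Bochner_Integration.integrable_bound)
  show "integrable M (\<lambda>x. (norm (f x))\<^sup>2 + (norm (g x))\<^sup>2)"
    using f g by (simp add: square_integrable_def)
  show "(\<lambda>x. f x * cnj (g x)) \<in> borel_measurable M"
    using f g borel_measurable_continuous_on[OF continuous_on_cnj[OF continuous_on_id]]
    by (auto simp: square_integrable_def intro!: borel_measurable_times)
  have "norm (f x) * norm (g x) \<le> (norm (f x))\<^sup>2 + (norm (g x))\<^sup>2" for x
    using sum_squares_bound[of "norm (f x)" "norm (g x)"]
      mult_nonneg_nonneg[OF norm_ge_zero norm_ge_zero, of "f x" "g x"] by linarith
  thus "AE x in M. norm (f x * cnj (g x)) \<le> norm ((norm (f x))\<^sup>2 + (norm (g x))\<^sup>2)"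
    by (simp add: norm_mult)
qed

lemma L2_inner_diff_left:
  assumes f: "square_integrable M f" and g: "square_integrable M g" and h: "square_integrable M h"
  shows "L2_inner M (\<lambda>x. f x - c * g x) h = L2_inner M f h - c * L2_inner M g h"
  using integrable_mult_cnj[OF f h] integrable_mult_cnj[OF g h]
  by (simp add: L2_inner_def left_diff_distrib mult.assoc)

lemma square_integrable_diff:
  assumes f: "square_integrable M f" and g: "square_integrable M g"
  shows "square_integrable M (\<lambda>x. f x - c * g x)"
  unfolding square_integrable_def
proof
  have [measurable]: "f \<in> borel_measurable M" "g \<in> borel_measurable M"
    using f g by (auto simp: square_integrable_def)
  show "(\<lambda>x. f x - c * g x) \<in> borel_measurable M" by measurable
  show "integrable M (\<lambda>x. (norm (f x - c * g x))\<^sup>2)"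
  proof (rule Bochner_Integration.integrable_bound)
    show "integrable M (\<lambda>x. 2 * (norm (f x))\<^sup>2 + 2 * (norm c)\<^sup>2 * (norm (g x))\<^sup>2)"
      using f g by (simp add: square_integrable_def)
    have "(norm (f x - c * g x))\<^sup>2 \<le> 2 * (norm (f x))\<^sup>2 + 2 * (norm c)\<^sup>2 * (norm (g x))\<^sup>2" for x
    proof -
      have "(norm (f x - c * g x))\<^sup>2 \<le> (norm (f x) + norm (c * g x))\<^sup>2"
        by (intro power_mono norm_triangle_ineq4) simp
      also have "\<dots> \<le> 2 * (norm (f x))\<^sup>2 + 2 * (norm (c * g x))\<^sup>2"
        using sum_squares_bound[of "norm (f x)" "norm (c * g x)"] by (simp add: power2_sum)
      finally show ?thesis by (simp add: norm_mult power_mult_distrib)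
    qed
    thus "AE x in M. norm ((norm (f x - c * g x))\<^sup>2) \<le>
        norm (2 * (norm (f x))\<^sup>2 + 2 * (norm c)\<^sup>2 * (norm (g x))\<^sup>2)"
      by simp
  qed measurable
qed

theorem bessel_inequality:
  fixes e :: "'i \<Rightarrow> 'a \<Rightarrow> complex" and c :: real
  assumes "finite F" and c_pos: "0 < c" and e: "\<And>k. square_integrable M (e k)"
    and ortho: "\<And>j k. L2_inner M (e j) (e k) = (if j = k then of_real c else 0)"
    and "square_integrable M f"
  shows "(\<Sum>k\<in>F. (norm (L2_inner M f (e k)))\<^sup>2) \<le> c * (LINT x|M. (norm (f x))\<^sup>2)"
  using assms(1,5)
proof (induction F arbitrary: f rule: finite_induct)
  case empty
  show ?case using c_pos by (simp add: mult_nonneg_nonneg)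
next
  case (insert k F)
  note f = insert.prems
  define a where "a = L2_inner M f (e k)"
  define f' where "f' x = f x - a / of_real c * e k x" for x
  have f': "square_integrable M f'"
    unfolding f'_def by (rule square_integrable_diff[OF f e])
  have inner_f': "L2_inner M f' h = L2_inner M f h - a / of_real c * L2_inner M (e k) h"
    if "square_integrable M h" for h
    unfolding f'_def by (rule L2_inner_diff_left[OF f e that])
  have same_coeff: "L2_inner M f' (e j) = L2_inner M f (e j)" if "j \<in> F" for j
    using that insert.hyps by (auto simp: inner_f'[OF e] ortho)
  have "L2_inner M f' (e k) = 0" using c_pos by (simp add: inner_f'[OF e] ortho a_def)
  moreover have "L2_inner M f' f' = L2_inner M f' f - cnj (a / of_real c) * L2_inner M f' (e k)"
    using inner_f'[OF f'] by (metis L2_inner_commute complex_cnj_diff complex_cnj_mult)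
  moreover have "L2_inner M (e k) f = cnj a"
    by (simp add: a_def L2_inner_commute[of M f])
  ultimately have "L2_inner M f' f' = L2_inner M f f - a * cnj a / of_real c"
    by (simp add: inner_f'[OF f])
  hence "of_real (LINT x|M. (norm (f' x))\<^sup>2) =
      complex_of_real ((LINT x|M. (norm (f x))\<^sup>2) - (norm a)\<^sup>2 / c)"
    by (simp only: L2_inner_self of_real_diff of_real_divide complex_norm_square)
  hence "c * (LINT x|M. (norm (f' x))\<^sup>2) = c * (LINT x|M. (norm (f x))\<^sup>2) - (norm a)\<^sup>2"
    using c_pos by (simp only: of_real_eq_iff) (simp add: field_simps)
  thus ?case using insert.IH[OF f'] insert.hyps same_coeff by (simp add: a_def)
qed

definition fourier_mode :: "real \<Rightarrow> int \<Rightarrow> real \<Rightarrow> complex" where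
  "fourier_mode \<Lambda> k t = indicator {-1..1} (t / \<Lambda>) * cis (- (t * (of_int k * pi / \<Lambda>)))"

lemma square_integrable_fourier_mode:
  assumes "0 < \<Lambda>"
  shows "square_integrable lborel (fourier_mode \<Lambda> k)"
  unfolding square_integrable_def
proof
  show "fourier_mode \<Lambda> k \<in> borel_measurable lborel"
    unfolding fourier_mode_def[abs_def] by measurable
  have "(norm (fourier_mode \<Lambda> k t))\<^sup>2 = indicat_real {-1..1} (t / \<Lambda>)" for t
    by (simp add: fourier_mode_def indicator_def norm_mult)
  thus "integrable lborel (\<lambda>t. (norm (fourier_mode \<Lambda> k t))\<^sup>2)"
    using lborel_integrable_real_affine[of "indicat_real {-1..1}" "1 / \<Lambda>" 0] assms by simp
qed

lemma fourier_mode_orthogonal: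
  assumes "0 < \<Lambda>"
  shows "L2_inner lborel (fourier_mode \<Lambda> j) (fourier_mode \<Lambda> k) =
    (if j = k then of_real (2 * \<Lambda>) else 0)"
proof -
  have "fourier_mode \<Lambda> j t * cnj (fourier_mode \<Lambda> k t) =
      indicator {-1..1} (t / \<Lambda>) * cis (t * ((k - j) * pi / \<Lambda>))" for t
    by (simp add: fourier_mode_def indicator_def cis_cnj cis_mult algebra_simps diff_divide_distrib)
  hence "L2_inner lborel (fourier_mode \<Lambda> j) (fourier_mode \<Lambda> k) =
      of_real \<Lambda> * fourier (indicator {-1..1}) (\<Lambda> * ((k - j) * pi / \<Lambda>))"
    unfolding L2_inner_def by (simp only: fourier_def[symmetric] fourier_rescale[OF assms])
  also have "\<Lambda> * ((k - j) * pi / \<Lambda>) = (k - j) * pi" using assms by simp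
  also have "fourier (indicator {-1..1}) ((k - j) * pi) = (if j = k then 2 else 0)"
  proof -
    have "sin ((k - j) * pi) = 0"
      unfolding sin_zero_iff_int2 by (rule exI[of _ "k - j"]) simp
    thus ?thesis by (simp add: fourier_indicator)
  qed
  finally show ?thesis by simp
qed

lemma L2_inner_fourier_mode:
  assumes "0 < \<Lambda>" and supp: "\<And>t. \<Lambda> < \<bar>t\<bar> \<Longrightarrow> f t = 0"
  shows "L2_inner lborel f (fourier_mode \<Lambda> k) = fourier f (of_int k * pi / \<Lambda>)"
  unfolding L2_inner_def fourier_def
proof (intro Bochner_Integration.integral_cong refl)
  fix t show "f t * cnj (fourier_mode \<Lambda> k t) = f t * cis (t * (of_int k * pi / \<Lambda>))"
    using supp[of t] assms(1)
    by (cases "\<Lambda> < \<bar>t\<bar>") (auto simp: fourier_mode_def indicator_def cis_cnj abs_le_iff field_simps)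
qed

corollary bessel_inequality_fourier:
  assumes "0 < \<Lambda>" and "square_integrable lborel f" and "\<And>t. \<Lambda> < \<bar>t\<bar> \<Longrightarrow> f t = 0" and "finite F"
  shows "(\<Sum>k\<in>F. (norm (fourier f (of_int k * pi / \<Lambda>)))\<^sup>2) \<le> 2 * \<Lambda> * (LINT t|lborel. (norm (f t))\<^sup>2)"
  using bessel_inequality[where e = "fourier_mode \<Lambda>" and c = "2 * \<Lambda>", OF \<open>finite F\<close> _
      square_integrable_fourier_mode fourier_mode_orthogonal assms(2)] assms(1)
  by (simp add: L2_inner_fourier_mode[OF assms(1,3)])

lemma integral_tail_tendsto_0:
  fixes f \<phi> :: "'a \<Rightarrow> real"
  assumes f: "integrable M f" and [measurable]: "\<phi> \<in> borel_measurable M"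
  shows "(\<lambda>n. LINT x|M. f x * indicator {x. real n < \<phi> x} x) \<longlonglongrightarrow> 0"
proof -
  have [measurable]: "f \<in> borel_measurable M" using f by auto
  have "(\<lambda>n. LINT x|M. f x * indicator {x. real n < \<phi> x} x) \<longlonglongrightarrow> (LINT x|M. 0)"
  proof (rule integral_dominated_convergence[where w = "\<lambda>x. norm (f x)"])
    show "AE x in M. (\<lambda>n. f x * indicator {x. real n < \<phi> x} x) \<longlonglongrightarrow> 0"
    proof (intro AE_I2 tendsto_eventually)
      fix x
      obtain n0 :: nat where "\<phi> x \<le> n0" using real_arch_simple by blast
      thus "\<forall>\<^sub>F n in sequentially. f x * indicator {x. real n < \<phi> x} x = 0"
        unfolding eventually_sequentially by (intro exI[of _ n0]) (auto simp: indicator_def)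
    qed
    show "AE x in M. norm (f x * indicator {x. real n < \<phi> x} x) \<le> norm (f x)" for n
      by (auto simp: indicator_def)
    show "(\<lambda>x. f x * indicator {x. real n < \<phi> x} x) \<in> borel_measurable M" for n
      unfolding indicator_def mem_Collect_eq by measurable
  qed (use f in simp_all)
  thus ?thesis by simp
qed

lemma jackson_tail_tendsto_0: "(\<lambda>n. jackson_tail (real n)) \<longlonglongrightarrow> 0"
  unfolding jackson_tail_def
  by (rule integral_tail_tendsto_0[OF integrable_jackson_weighted]) measurable

definition truncation :: "real \<Rightarrow> (real \<Rightarrow> complex) \<Rightarrow> real \<Rightarrow> complex" where
  "truncation R f t = (if norm (f t) \<le> R then f t else 0)"

lemma borel_measurable_truncation [measurable]:
  assumes [measurable]: "f \<in> borel_measurable borel"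
  shows "truncation R f \<in> borel_measurable borel"
  unfolding truncation_def[abs_def] by measurable

lemma norm_fourier_diff_truncation_le:
  assumes [measurable]: "f \<in> borel_measurable borel"
    and g: "integrable lborel g" and dom: "AE t in lborel. norm (f t) \<le> g t"
  shows "norm (fourier f v - fourier (truncation R f) v)
           \<le> (LINT t|lborel. g t * indicator {t. R < g t} t)"
proof -
  let ?h = "truncation R f"
  have [measurable]: "g \<in> borel_measurable borel" using g by auto
  have f: "integrable lborel f"
    by (rule Bochner_Integration.integrable_bound[OF g]) (use dom in \<open>auto elim: eventually_mono\<close>)
  have h: "integrable lborel ?h"
    by (rule Bochner_Integration.integrable_bound[OF f]) (auto simp: truncation_def)
  have "norm (fourier f v - fourier ?h v) \<le> (LINT t|lborel. norm (f t - ?h t))"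
    unfolding fourier_diff[OF f h, symmetric] by (rule norm_fourier_le)
  also have "\<dots> \<le> (LINT t|lborel. g t * indicator {t. R < g t} t)"
  proof (rule integral_mono_AE)
    show "integrable lborel (\<lambda>t. g t * indicator {t. R < g t} t)"
      by (rule Bochner_Integration.integrable_bound[OF g]) (auto simp: indicator_def)
    show "AE t in lborel. norm (f t - ?h t) \<le> g t * indicator {t. R < g t} t"
      using dom
    proof eventually_elim
      case (elim t)
      thus ?case using order_trans[OF norm_ge_zero elim] by (auto simp: indicator_def truncation_def)
    qed
  qed (use f h in simp)
  finally show ?thesis .
qed

lemma square_integrable_truncation:
  assumes [measurable]: "f \<in> borel_measurable borel"
    and g: "integrable lborel g" and dom: "AE t in lborel. norm (f t) \<le> g t"
    and R: "0 \<le> R"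
  shows "square_integrable lborel (truncation R f)"
    and "(LINT t|lborel. (norm (truncation R f t))\<^sup>2) \<le> R * (LINT t|lborel. g t)"
proof -
  let ?h = "truncation R f"
  have square_le: "AE t in lborel. (norm (?h t))\<^sup>2 \<le> R * g t"
    using dom
  proof eventually_elim
    case (elim t)
    have "norm (f t) * norm (f t) \<le> R * g t" if "norm (f t) \<le> R"
      using elim that by (intro mult_mono) (auto intro: order_trans[OF norm_ge_zero])
    thus ?case
      using R order_trans[OF norm_ge_zero elim] by (simp add: truncation_def power2_eq_square)
  qed
  show "square_integrable lborel ?h"
    unfolding square_integrable_def
  proof
    show "integrable lborel (\<lambda>t. (norm (?h t))\<^sup>2)"
      by (rule Bochner_Integration.integrable_bound[OF integrable_mult_right[OF g, of R]])
         (use square_le in \<open>auto elim: eventually_mono\<close>)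
  qed simp
  hence "(LINT t|lborel. (norm (?h t))\<^sup>2) \<le> (LINT t|lborel. R * g t)"
    using g square_le by (intro integral_mono_AE) (auto simp: square_integrable_def)
  thus "(LINT t|lborel. (norm (?h t))\<^sup>2) \<le> R * (LINT t|lborel. g t)" by simp
qed

text \<open>Off the set where the majorant is large the functions are uniformly bounded in \<open>L\<^sup>2\<close>, so that
  Bessel's inequality applies.\<close>

lemma card_large_fourier_coefficients_le:
  fixes \<Lambda> \<eta> :: real
  assumes \<Lambda>: "0 < \<Lambda>" and \<eta>: "0 < \<eta>" and g: "integrable lborel g"
  obtains C where "\<And>f F. f \<in> borel_measurable borel \<Longrightarrow> (AE t in lborel. norm (f t) \<le> g t) \<Longrightarrow>
    (\<And>t. \<Lambda> < \<bar>t\<bar> \<Longrightarrow> f t = 0) \<Longrightarrow> finite F \<Longrightarrow>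
    (\<And>k. k \<in> F \<Longrightarrow> 2 * \<eta> < norm (fourier f (of_int k * pi / \<Lambda>))) \<Longrightarrow> real (card F) \<le> C"
proof -
  have "eventually (\<lambda>R. (LINT t|lborel. g t * indicator {t. real R < g t} t) < \<eta>) sequentially"
    using g \<eta> by (intro order_tendstoD(2)[OF integral_tail_tendsto_0]) auto
  then obtain R :: nat where R: "(LINT t|lborel. g t * indicator {t. real R < g t} t) < \<eta>"
    by (auto simp: eventually_sequentially)
  show ?thesis
  proof (rule that)
    fix f :: "real \<Rightarrow> complex" and F
    assume f: "f \<in> borel_measurable borel" "AE t in lborel. norm (f t) \<le> g t"
      and supp: "\<And>t. \<Lambda> < \<bar>t\<bar> \<Longrightarrow> f t = 0" and F: "finite F"
      and large: "\<And>k. k \<in> F \<Longrightarrow> 2 * \<eta> < norm (fourier f (of_int k * pi / \<Lambda>))"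
    define h where "h = truncation (real R) f"
    note trunc = square_integrable_truncation[OF f(1) g f(2) of_nat_0_le_iff, of R, folded h_def]
    have "\<eta> \<le> norm (fourier h (of_int k * pi / \<Lambda>))" if "k \<in> F" for k
      using large[OF that] R norm_fourier_diff_truncation_le[OF f(1) g f(2), of "of_int k * pi / \<Lambda>" R]
        norm_triangle_ineq2[of "fourier f (of_int k * pi / \<Lambda>)" "fourier h (of_int k * pi / \<Lambda>)"]
      unfolding h_def by linarith
    hence "real (card F) * \<eta>\<^sup>2 \<le> (\<Sum>k\<in>F. (norm (fourier h (of_int k * pi / \<Lambda>)))\<^sup>2)"
      using \<eta> by (intro sum_bounded_below power_mono) auto
    also have "\<dots> \<le> 2 * \<Lambda> * (LINT t|lborel. (norm (h t))\<^sup>2)"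
      by (rule bessel_inequality_fourier[OF \<Lambda> _ _ F])
         (use trunc supp in \<open>auto simp: h_def truncation_def\<close>)
    also have "\<dots> \<le> 2 * \<Lambda> * (R * (LINT t|lborel. g t))"
      using trunc \<Lambda> by (intro mult_left_mono) auto
    finally show "real (card F) \<le> 2 * \<Lambda> * (R * (LINT t|lborel. g t)) / \<eta>\<^sup>2"
      using \<eta> by (simp add: pos_le_divide_eq)
  qed
qed

lemma dominated_riemann_lebesgue:
  fixes f :: "'n \<Rightarrow> real \<Rightarrow> complex" and g :: "real \<Rightarrow> real" and \<Lambda> :: real and L :: "int \<Rightarrow> complex"
  assumes \<Lambda>: "0 < \<Lambda>" and f: "\<And>n. f n \<in> borel_measurable borel"
    and g: "integrable lborel g" and dom: "\<And>n. AE t in lborel. norm (f n t) \<le> g t"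
    and supp: "\<And>n t. \<Lambda> < \<bar>t\<bar> \<Longrightarrow> f n t = 0"
    and lim: "\<And>k. ((\<lambda>n. fourier (f n) (of_int k * pi / \<Lambda>)) \<longlongrightarrow> L k) net" and net: "net \<noteq> bot"
  shows "(L \<longlongrightarrow> 0) cofinite"
proof (rule tendstoI)
  fix e :: real assume e_pos: "0 < e"
  let ?large = "{k. \<not> dist (L k) 0 < e}"
  have third_pos: "0 < e / 3" using e_pos by simp
  obtain C where C: "\<And>n F. finite F \<Longrightarrow>
      (\<And>k. k \<in> F \<Longrightarrow> 2 * (e / 3) < norm (fourier (f n) (of_int k * pi / \<Lambda>))) \<Longrightarrow> real (card F) \<le> C"
    by (rule card_large_fourier_coefficients_le[OF \<Lambda> third_pos g]) (rule that, use f dom supp in blast)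
  have card_le: "real (card F) \<le> C" if F: "finite F" "F \<subseteq> ?large" for F
  proof -
    have "eventually (\<lambda>n. \<forall>k\<in>F. 2 * (e / 3) < norm (fourier (f n) (of_int k * pi / \<Lambda>))) net"
      using F e_pos
      by (intro eventually_ball_finite ballI order_tendstoD(1)[OF tendsto_norm[OF lim]]) fastforce+
    then obtain n where "\<forall>k\<in>F. 2 * (e / 3) < norm (fourier (f n) (of_int k * pi / \<Lambda>))"
      using eventually_happens'[OF net] by blast
    thus ?thesis using C[OF F(1)] by blast
  qed
  have "finite ?large"
  proof (rule ccontr)
    assume "infinite ?large"
    then obtain F where "finite F" "card F = nat \<lceil>C\<rceil> + 1" "F \<subseteq> ?large"
      by (metis infinite_arbitrarily_large)
    thus False using card_le[of F] by linarith
  qed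
  thus "eventually (\<lambda>k. dist (L k) 0 < e) cofinite" by (simp add: eventually_cofinite)
qed

subsection \<open>Laplace transforms\<close>

definition laplace :: "(real \<Rightarrow> real) \<Rightarrow> complex \<Rightarrow> complex" where
  "laplace f s = (LINT u|lborel. of_real (f u) * exp (- s * of_real u))"

lemma laplace_eq_fourier:
  "laplace f (Complex \<epsilon> t) = fourier (\<lambda>u. of_real (f u * exp (- \<epsilon> * u))) (- t)"
  unfolding laplace_def fourier_def
  by (intro Bochner_Integration.integral_cong refl)
     (simp add: complex_eq_iff Re_exp Im_exp mult.commute)

lemma laplace_cnj: "laplace f (cnj s) = cnj (laplace f s)"
  unfolding laplace_def
  by (subst Bochner_Integration.integral_cnj[symmetric]) (simp add: exp_cnj)

lemma integrable_exp_atLeast: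
  fixes a l :: real
  assumes a: "0 < a"
  shows "integrable lborel (\<lambda>u. indicator {l..} u * exp (- a * u))"
proof -
  have "(\<lambda>u. exp (- a * u)) absolutely_integrable_on {l..}"
    using has_integral_exp_minus_to_infinity[OF a]
    by (intro nonnegative_absolutely_integrable_1) (auto simp: integrable_on_def)
  thus ?thesis
    unfolding set_integrable_def by (subst (asm) integrable_completion) simp_all
qed

lemma integral_exp_atLeast:
  fixes a l :: real
  assumes a: "0 < a"
  shows "(LINT u|lborel. indicator {l..} u * exp (- a * u)) = exp (- a * l) / a"
proof -
  have "integral UNIV (\<lambda>u. indicator {l..} u * exp (- a * u)) = integral {l..} (\<lambda>u. exp (- a * u))"
    by (subst integral_restrict_UNIV[symmetric])
       (auto intro!: arg_cong[where f = "integral UNIV"] simp: indicator_def)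
  thus ?thesis
    using integral_unique[OF has_integral_exp_minus_to_infinity[OF a, of l]]
      integral_lborel[OF integrable_exp_atLeast[OF a, of l]] by simp
qed

lemma integrable_cexp_atLeast:
  fixes s :: complex and l :: real
  assumes "0 < Re s"
  shows "integrable lborel (\<lambda>u. of_real (indicator {l..} u) * exp (- s * of_real u))"
  by (rule Bochner_Integration.integrable_bound[OF integrable_exp_atLeast[OF assms, of l]])
     (auto simp: norm_mult)

lemma laplace_indicator_atLeast:
  assumes s: "0 < Re s"
  shows "laplace (indicator {l..}) s = exp (- s * of_real l) / s"
proof -
  let ?F = "\<lambda>u::real. - exp (- s * of_real u) / s"
  have s_nonzero: "s \<noteq> 0" using s by auto
  have "laplace (indicator {l..}) s = (LINT u|lborel. indicator {l<..} u *\<^sub>R exp (- s * of_real u))"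
    unfolding laplace_def
    by (intro integral_cong_AE)
       (use AE_lborel_singleton[of l] in \<open>auto simp: indicator_def elim!: eventually_mono\<close>)
  also have "\<dots> = (LBINT u=ereal l..\<infinity>. exp (- s * of_real u))"
    by (simp add: interval_integral_to_infinity_eq set_lebesgue_integral_def)
  also have "\<dots> = 0 - ?F l"
  proof (rule interval_integral_FTC_integrable)
    show "(?F has_vector_derivative exp (- s * of_real u)) (at u)" for u
      using s_nonzero by (auto intro!: derivative_eq_intros has_vector_derivative_real_field)
    show "set_integrable lborel (einterval (ereal l) \<infinity>) (\<lambda>u. exp (- s * of_real u))"
      unfolding set_integrable_def
      by (rule Bochner_Integration.integrable_bound[OF integrable_exp_atLeast[OF s, of l]])
         (auto simp: einterval_def indicator_def)
    show "((?F \<circ> real_of_ereal) \<longlongrightarrow> ?F l) (at_right (ereal l))"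
      unfolding ereal_tendsto_simps by (intro tendsto_intros s_nonzero)
    show "((?F \<circ> real_of_ereal) \<longlongrightarrow> 0) (at_left \<infinity>)"
      unfolding ereal_tendsto_simps
    proof (rule tendsto_norm_zero_cancel)
      have "filterlim (\<lambda>u. - (Re s * u)) at_bot at_top"
        using filterlim_tendsto_pos_mult_at_top[OF tendsto_const s filterlim_ident]
        by (simp add: filterlim_uminus_at_bot)
      hence "((\<lambda>u. exp (- (Re s * u)) / norm s) \<longlongrightarrow> 0) at_top"
        using tendsto_divide_zero[OF filterlim_compose[OF exp_at_bot]] by blast
      thus "((\<lambda>u. norm (?F u)) \<longlongrightarrow> 0) at_top" by (simp add: norm_divide)
    qed
  qed auto
  finally show ?thesis by simp
qed

subsection \<open>A Tauberian theorem for slowly oscillating functions\<close>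

definition slowly_oscillating :: "(real \<Rightarrow> real) \<Rightarrow> bool" where
  "slowly_oscillating f \<longleftrightarrow>
    (\<forall>e>0. \<exists>\<delta>>0. \<exists>U. \<forall>u\<ge>U. \<forall>v\<ge>U. \<bar>u - v\<bar> \<le> \<delta> \<longrightarrow> \<bar>f u - f v\<bar> \<le> e)"

definition laplace_boundary_dominated :: "(real \<Rightarrow> real) \<Rightarrow> bool" where
  "laplace_boundary_dominated f \<longleftrightarrow>
    (\<forall>T>0. \<exists>g. integrable lborel g \<and>
      (\<forall>\<epsilon>\<in>{0<..<1}. AE t in lborel. \<bar>t\<bar> < T \<longrightarrow> norm (laplace f (Complex \<epsilon> t)) \<le> g t))"

lemma slowly_oscillating_increments_eventually_linear:
  assumes "slowly_oscillating f"
  obtains \<delta> U where "0 < \<delta>" "\<And>u v. U \<le> u \<Longrightarrow> U \<le> v \<Longrightarrow> \<bar>f u - f v\<bar> \<le> 1 + \<bar>u - v\<bar> / \<delta>"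
proof -
  obtain \<delta> U where \<delta>: "0 < \<delta>"
    and osc: "\<And>u v. U \<le> u \<Longrightarrow> U \<le> v \<Longrightarrow> \<bar>u - v\<bar> \<le> \<delta> \<Longrightarrow> \<bar>f u - f v\<bar> \<le> 1"
    using assms[unfolded slowly_oscillating_def, rule_format, OF zero_less_one] by blast
  have steps: "\<bar>f v - f u\<bar> \<le> real n" if "U \<le> u" "u \<le> v" "v \<le> u + real n * \<delta>" for u v n
    using that
  proof (induction n arbitrary: v)
    case (Suc n)
    define w where "w = max u (v - \<delta>)"
    have "\<bar>f w - f u\<bar> \<le> real n"
      using Suc.prems \<delta> by (intro Suc.IH) (auto simp: w_def algebra_simps)
    moreover have "\<bar>f v - f w\<bar> \<le> 1"
      using Suc.prems \<delta> by (intro osc) (auto simp: w_def)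
    ultimately show ?case by simp
  qed simp
  have ordered: "\<bar>f v - f u\<bar> \<le> 1 + \<bar>v - u\<bar> / \<delta>" if "U \<le> u" "u \<le> v" for u v
  proof -
    define n where "n = nat \<lceil>(v - u) / \<delta>\<rceil>"
    have n_bounds: "(v - u) / \<delta> \<le> n" "n \<le> 1 + (v - u) / \<delta>"
      using that \<delta> by (auto simp: n_def of_nat_nat) linarith
    hence "\<bar>f v - f u\<bar> \<le> n"
      using that \<delta> by (intro steps) (auto simp: field_simps)
    thus ?thesis using n_bounds that by simp
  qed
  show ?thesis
  proof (rule that[OF \<delta>])
    fix u v assume "U \<le> u" "U \<le> v"
    thus "\<bar>f u - f v\<bar> \<le> 1 + \<bar>u - v\<bar> / \<delta>"
      using ordered[of u v] ordered[of v u] by (cases "u \<le> v") (simp_all add: abs_minus_commute)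
  qed
qed

lemma slowly_oscillating_increments_linear:
  assumes "slowly_oscillating f" and bdd: "\<And>U. bounded (f ` {..U})"
  obtains A where "\<And>u v. \<bar>f u - f v\<bar> \<le> A * (1 + \<bar>u - v\<bar>)"
proof -
  obtain \<delta> U where \<delta>: "0 < \<delta>"
    and far: "\<And>u v. U \<le> u \<Longrightarrow> U \<le> v \<Longrightarrow> \<bar>f u - f v\<bar> \<le> 1 + \<bar>u - v\<bar> / \<delta>"
    using slowly_oscillating_increments_eventually_linear[OF assms(1)] by blast
  obtain B where B: "\<And>u. u \<le> U \<Longrightarrow> \<bar>f u\<bar> \<le> B"
    using bdd[of U] by (auto simp: bounded_iff)
  have B_nonneg: "0 \<le> B" using B[of U] by simp
  have clamp: "\<bar>f u - f (max U u)\<bar> \<le> 2 * B" for u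
    using B[of u] B[of U] B_nonneg by (auto simp: max_def)
  show ?thesis
  proof (rule that[of "4 * B + 1 + 1 / \<delta>"])
    fix u v
    have "\<bar>f u - f v\<bar> \<le> \<bar>f u - f (max U u)\<bar> + \<bar>f (max U u) - f (max U v)\<bar> + \<bar>f v - f (max U v)\<bar>"
      by arith
    also have "\<dots> \<le> 2 * B + (1 + \<bar>max U u - max U v\<bar> / \<delta>) + 2 * B"
      by (intro add_mono clamp far) auto
    also have "\<dots> \<le> 2 * B + (1 + \<bar>u - v\<bar> / \<delta>) + 2 * B"
      using \<delta> by (intro add_mono divide_right_mono order_refl) auto
    also have "\<dots> \<le> (4 * B + 1 + 1 / \<delta>) * (1 + \<bar>u - v\<bar>)"
      using B_nonneg \<delta> by (simp add: algebra_simps)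
    finally show "\<bar>f u - f v\<bar> \<le> (4 * B + 1 + 1 / \<delta>) * (1 + \<bar>u - v\<bar>)" .
  qed
qed

lemma at_top_le_cofinite: "(at_top :: int filter) \<le> cofinite"
proof (rule filter_leI)
  fix P :: "int \<Rightarrow> bool" assume "eventually P cofinite"
  hence "\<forall>\<^sub>F k in at_top. \<forall>j\<in>{j. \<not> P j}. j < k"
    unfolding eventually_cofinite by (intro eventually_ball_finite ballI eventually_gt_at_top)
  thus "eventually P at_top" by (rule eventually_mono) blast
qed

lemma filterlim_floor_divide_cofinite:
  fixes d :: real
  assumes "0 < d"
  shows "filterlim (\<lambda>u. \<lfloor>u / d\<rfloor>) cofinite at_top"
proof (rule filterlim_mono[OF _ at_top_le_cofinite order_refl])
  have "filterlim (\<lambda>u. (1 / d) * u) at_top at_top"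
    using assms by (intro filterlim_tendsto_pos_mult_at_top[OF tendsto_const _ filterlim_ident]) simp
  thus "filterlim (\<lambda>u. \<lfloor>u / d\<rfloor>) at_top at_top"
    by (intro filterlim_compose[OF filterlim_floor_sequentially]) simp
qed

lemma filterlim_floor_divide_mult_at_top:
  fixes d :: real
  assumes "0 < d"
  shows "filterlim (\<lambda>u. of_int \<lfloor>u / d\<rfloor> * d) at_top at_top"
proof (rule filterlim_at_top_mono)
  show "filterlim (\<lambda>u. - d + u) at_top at_top"
    by (rule filterlim_tendsto_add_at_top[OF tendsto_const filterlim_ident])
  have "- d + u \<le> of_int \<lfloor>u / d\<rfloor> * d" for u
    using floor_divide_upper[OF assms, of u] by (simp add: distrib_right)
  thus "\<forall>\<^sub>F u in at_top. - d + u \<le> of_int \<lfloor>u / d\<rfloor> * d" by simp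
qed

locale tauberian_function =
  fixes f :: "real \<Rightarrow> real" and A :: real
  assumes measurable [measurable]: "f \<in> borel_measurable borel"
    and eq_0: "\<And>u. u < 0 \<Longrightarrow> f u = 0"
    and increments: "\<And>u v. \<bar>f u - f v\<bar> \<le> A * (1 + \<bar>u - v\<bar>)"
    and slow: "slowly_oscillating f"
begin

lemma A_nonneg: "0 \<le> A"
  using increments[of 0 0] by simp

lemma integrable_exp_damped:
  assumes \<epsilon>: "0 < \<epsilon>"
  shows "integrable lborel (\<lambda>u. f u * exp (- \<epsilon> * u))"
proof (rule Bochner_Integration.integrable_bound)
  define C where "C = A * (2 + 2 / \<epsilon>)"
  show "integrable lborel (\<lambda>u. C * (indicator {0..} u * exp (- (\<epsilon> / 2) * u)))"
    using \<epsilon> by (intro integrable_mult_right integrable_exp_atLeast) simp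
  have "\<bar>f u * exp (- \<epsilon> * u)\<bar> \<le> C * exp (- (\<epsilon> / 2) * u)" if "0 \<le> u" for u
  proof -
    have "\<bar>f u\<bar> \<le> A * (2 + u)" using increments[of u "-1"] eq_0[of "-1"] that by simp
    also have "2 + u \<le> (2 + 2 / \<epsilon>) * (1 + u * (\<epsilon> / 2))" using that \<epsilon> by (simp add: field_simps)
    also have "\<dots> \<le> (2 + 2 / \<epsilon>) * exp (u * (\<epsilon> / 2))"
      using \<epsilon> by (intro mult_left_mono exp_ge_add_one_self) auto
    finally have "\<bar>f u\<bar> \<le> C * exp (u * (\<epsilon> / 2))"
      using A_nonneg by (simp add: C_def mult.assoc mult_left_mono)
    hence "\<bar>f u\<bar> * exp (- \<epsilon> * u) \<le> C * exp (u * (\<epsilon> / 2)) * exp (- \<epsilon> * u)"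
      by (intro mult_right_mono) auto
    thus ?thesis by (simp add: abs_mult mult.assoc field_simps flip: exp_add)
  qed
  thus "AE u in lborel. norm (f u * exp (- \<epsilon> * u)) \<le>
      norm (C * (indicator {0..} u * exp (- (\<epsilon> / 2) * u)))"
    using eq_0
    by (intro AE_I2) (auto simp: indicator_def not_le intro: order_trans[OF _ abs_ge_self])
qed simp

definition mean :: "real \<Rightarrow> real \<Rightarrow> real" where
  "mean \<rho> h = (LINT v|lborel. f (h - v / \<rho>) * jackson v) / jackson_mass"

lemma abs_diff_shift_le:
  assumes "1 \<le> \<rho>"
  shows "\<bar>f h - f (h - v / \<rho>)\<bar> \<le> A * (1 + \<bar>v\<bar>)"
proof -
  have "\<bar>v\<bar> / \<rho> \<le> \<bar>v\<bar>" using assms mult_right_mono[of 1 \<rho> "\<bar>v\<bar>"] by (simp add: field_simps)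
  hence "A * (1 + \<bar>h - (h - v / \<rho>)\<bar>) \<le> A * (1 + \<bar>v\<bar>)"
    using A_nonneg assms by (intro mult_left_mono) auto
  thus ?thesis using increments[of h "h - v / \<rho>"] by linarith
qed

lemma abs_shift_mult_jackson_le:
  assumes "1 \<le> \<rho>"
  shows "\<bar>f (h - v / \<rho>)\<bar> * jackson v \<le> (\<bar>f h\<bar> + A) * ((1 + \<bar>v\<bar>) * jackson v)"
proof -
  have "\<bar>f (h - v / \<rho>)\<bar> \<le> \<bar>f h\<bar> + A * (1 + \<bar>v\<bar>)" using abs_diff_shift_le[OF assms, of h v] by simp
  also have "\<dots> \<le> (\<bar>f h\<bar> + A) * (1 + \<bar>v\<bar>)" by (simp add: distrib_left distrib_right)
  finally have "\<bar>f (h - v / \<rho>)\<bar> \<le> (\<bar>f h\<bar> + A) * (1 + \<bar>v\<bar>)" .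
  from mult_right_mono[OF this jackson_nonneg[of v]] show ?thesis by (simp only: mult.assoc)
qed

lemma integrable_shift_mult_jackson:
  assumes "1 \<le> \<rho>"
  shows "integrable lborel (\<lambda>v. f (h - v / \<rho>) * jackson v)"
proof (rule Bochner_Integration.integrable_bound)
  show "integrable lborel (\<lambda>v. (\<bar>f h\<bar> + A) * ((1 + \<bar>v\<bar>) * jackson v))"
    by (rule integrable_mult_right[OF integrable_jackson_weighted])
  show "AE v in lborel. norm (f (h - v / \<rho>) * jackson v) \<le>
      norm ((\<bar>f h\<bar> + A) * ((1 + \<bar>v\<bar>) * jackson v))"
    using order_trans[OF abs_shift_mult_jackson_le[OF assms, of h] abs_ge_self] jackson_nonneg
    by (intro AE_I2) (simp add: abs_mult)
qed simp

lemma abs_diff_mean_le: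
  assumes \<rho>: "1 \<le> \<rho>" and "0 \<le> \<eta>" and near: "\<And>v. \<bar>v\<bar> \<le> V \<Longrightarrow> \<bar>f h - f (h - v / \<rho>)\<bar> \<le> \<eta>"
  shows "\<bar>f h - mean \<rho> h\<bar> \<le> \<eta> + A * jackson_tail V / jackson_mass"
proof -
  define tail where "tail v = (1 + \<bar>v\<bar>) * jackson v * indicator {v. V < \<bar>v\<bar>} v" for v
  have tail: "integrable lborel tail"
    unfolding tail_def by (rule integrable_real_mult_indicator[OF _ integrable_jackson_weighted]) measurable
  have diff: "integrable lborel (\<lambda>v. (f h - f (h - v / \<rho>)) * jackson v)"
    and mean_diff: "jackson_mass * (f h - mean \<rho> h) = (LINT v|lborel. (f h - f (h - v / \<rho>)) * jackson v)"
    using integrable_shift_mult_jackson[OF \<rho>] integrable_jackson jackson_mass_pos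
    by (simp_all add: left_diff_distrib right_diff_distrib mean_def flip: jackson_mass_def)
  have pointwise: "\<bar>f h - f (h - v / \<rho>)\<bar> * jackson v \<le> \<eta> * jackson v + A * tail v" for v
  proof (cases "V < \<bar>v\<bar>")
    case True
    have "\<bar>f h - f (h - v / \<rho>)\<bar> * jackson v \<le> A * (1 + \<bar>v\<bar>) * jackson v"
      by (intro mult_right_mono abs_diff_shift_le \<rho> jackson_nonneg)
    thus ?thesis
      using True assms(2) jackson_nonneg[of v] by (simp add: tail_def add_increasing mult.assoc)
  next
    case False
    thus ?thesis using near[of v] jackson_nonneg[of v] by (simp add: tail_def mult_right_mono)
  qed
  have "norm (LINT v|lborel. (f h - f (h - v / \<rho>)) * jackson v) \<le>
      (LINT v|lborel. \<eta> * jackson v + A * tail v)"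
  proof (rule Bochner_Integration.integral_norm_bound_integral[OF diff])
    show "integrable lborel (\<lambda>v. \<eta> * jackson v + A * tail v)"
      by (intro Bochner_Integration.integrable_add integrable_mult_right integrable_jackson tail)
    show "norm ((f h - f (h - v / \<rho>)) * jackson v) \<le> \<eta> * jackson v + A * tail v" for v
      using pointwise[of v] jackson_nonneg[of v] by (simp add: abs_mult)
  qed
  also have "\<dots> = \<eta> * jackson_mass + A * jackson_tail V"
    using tail integrable_jackson by (simp add: jackson_mass_def jackson_tail_def flip: tail_def)
  finally have "jackson_mass * \<bar>f h - mean \<rho> h\<bar> \<le> \<eta> * jackson_mass + A * jackson_tail V"
    using jackson_mass_pos by (simp add: abs_mult flip: mean_diff)
  thus ?thesis using jackson_mass_pos by (simp add: field_simps)
qed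

lemma mean_approximates:
  assumes "0 < e"
  obtains \<rho> where "1 \<le> \<rho>" "\<forall>\<^sub>F h in at_top. \<bar>f h - mean \<rho> h\<bar> \<le> e"
proof -
  have half_pos: "0 < e / 2" using assms by simp
  have "(\<lambda>n. A * jackson_tail (real n) / jackson_mass) \<longlonglongrightarrow> 0"
    by (intro tendsto_divide_zero tendsto_mult_right_zero jackson_tail_tendsto_0)
  hence "eventually (\<lambda>n. A * jackson_tail (real n) / jackson_mass < e / 2) sequentially"
    using half_pos by (rule order_tendstoD(2))
  then obtain V :: nat where V: "A * jackson_tail (real V) / jackson_mass < e / 2"
    by (auto simp: eventually_sequentially)
  obtain \<delta> U where \<delta>: "0 < \<delta>"
    and osc: "\<And>u v. U \<le> u \<Longrightarrow> U \<le> v \<Longrightarrow> \<bar>u - v\<bar> \<le> \<delta> \<Longrightarrow> \<bar>f u - f v\<bar> \<le> e / 2"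
    using slow[unfolded slowly_oscillating_def, rule_format, OF half_pos] by blast
  define \<rho> where "\<rho> = max 1 (V / \<delta>)"
  have \<rho>: "1 \<le> \<rho>" "V / \<rho> \<le> \<delta>" using \<delta> by (auto simp: \<rho>_def max_def field_simps)
  have "\<bar>f h - mean \<rho> h\<bar> \<le> e" if h: "U + \<delta> \<le> h" for h
  proof -
    have "\<bar>f h - f (h - v / \<rho>)\<bar> \<le> e / 2" if "\<bar>v\<bar> \<le> real V" for v
    proof -
      have "\<bar>v / \<rho>\<bar> \<le> V / \<rho>" using that \<rho>(1) by (simp add: divide_right_mono)
      hence "\<bar>v / \<rho>\<bar> \<le> \<delta>" using \<rho>(2) by linarith
      thus ?thesis using h \<delta> by (intro osc) linarith+
    qed
    from abs_diff_mean_le[where V = V, OF \<rho>(1) less_imp_le[OF half_pos] this]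
    show ?thesis using V by linarith
  qed
  hence "\<forall>\<^sub>F h in at_top. \<bar>f h - mean \<rho> h\<bar> \<le> e"
    unfolding eventually_at_top_linorder by blast
  with \<rho>(1) show ?thesis by (rule that)
qed

lemma damped_integral_tendsto:
  assumes \<rho>: "1 \<le> \<rho>" and \<epsilon>: "\<And>n. 0 \<le> \<epsilon> n" "\<epsilon> \<longlonglongrightarrow> 0"
  shows "(\<lambda>n. LINT v|lborel. f (h - v / \<rho>) * exp (- \<epsilon> n * (h - v / \<rho>)) * jackson v)
    \<longlonglongrightarrow> (LINT v|lborel. f (h - v / \<rho>) * jackson v)"
proof (rule integral_dominated_convergence)
  show "integrable lborel (\<lambda>v. \<bar>f (h - v / \<rho>) * jackson v\<bar>)"
    using integrable_shift_mult_jackson[OF \<rho>] by (rule integrable_abs)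
  show "AE v in lborel. (\<lambda>n. f (h - v / \<rho>) * exp (- \<epsilon> n * (h - v / \<rho>)) * jackson v)
      \<longlonglongrightarrow> f (h - v / \<rho>) * jackson v"
    by (rule AE_I2) (use \<epsilon>(2) in \<open>auto intro!: tendsto_eq_intros\<close>)
  fix n
  have "\<bar>f u * exp (- \<epsilon> n * u)\<bar> \<le> \<bar>f u\<bar>" for u
    using eq_0[of u] \<epsilon>(1)[of n] by (cases "u < 0") (auto simp: abs_mult mult_left_le)
  thus "AE v in lborel. norm (f (h - v / \<rho>) * exp (- \<epsilon> n * (h - v / \<rho>)) * jackson v)
      \<le> \<bar>f (h - v / \<rho>) * jackson v\<bar>"
    by (intro AE_I2) (simp add: abs_mult[of _ "jackson _"] mult_right_mono)
qed simp_all

lemma fourier_bspline_mult_laplace_tendsto: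
  assumes \<rho>: "1 \<le> \<rho>" and \<epsilon>: "\<And>n. 0 < \<epsilon> n" "\<epsilon> \<longlonglongrightarrow> 0"
  shows "(\<lambda>n. fourier (\<lambda>t. bspline 3 (t / \<rho>) * laplace f (Complex (\<epsilon> n) t)) h)
    \<longlonglongrightarrow> of_real (LINT v|lborel. f (h - v / \<rho>) * jackson v)"
proof -
  have "fourier (\<lambda>t. bspline 3 (t / \<rho>) * laplace f (Complex (\<epsilon> n) t)) h =
      of_real (LINT v|lborel. f (h - v / \<rho>) * exp (- \<epsilon> n * (h - v / \<rho>)) * jackson v)" for n
    unfolding laplace_eq_fourier
    by (rule fourier_bspline_mult_fourier[OF integrable_exp_damped[OF \<epsilon>(1)]]) (use \<rho> in simp)
  thus ?thesis
    by (simp only:) (intro tendsto_of_real damped_integral_tendsto[OF \<rho> less_imp_le[OF \<epsilon>(1)] \<epsilon>(2)])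
qed

lemma mean_tendsto_0_along_grid:
  assumes dom: "laplace_boundary_dominated f" and \<rho>: "1 \<le> \<rho>" and \<Lambda>: "4 * \<rho> \<le> \<Lambda>"
  shows "((\<lambda>k::int. mean \<rho> (of_int k * pi / \<Lambda>)) \<longlongrightarrow> 0) cofinite"
proof -
  define \<epsilon> where "\<epsilon> n = 1 / (real n + 2)" for n
  have \<epsilon>: "0 < \<epsilon> n" "\<epsilon> n < 1" for n by (auto simp: \<epsilon>_def)
  have \<epsilon>_tendsto: "\<epsilon> \<longlonglongrightarrow> 0" unfolding \<epsilon>_def
    using LIMSEQ_ignore_initial_segment[OF lim_const_over_n[of "1::real"], of 2]
    by (simp add: add.commute)
  obtain g where g: "integrable lborel g" and g_ge: "\<And>n. AE t in lborel.
      \<bar>t\<bar> < 4 * \<rho> + 1 \<longrightarrow> norm (laplace f (Complex (\<epsilon> n) t)) \<le> g t"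
    using dom[unfolded laplace_boundary_dominated_def, rule_format, of "4 * \<rho> + 1"] \<epsilon> \<rho> by auto
  define G where "G n t = bspline 3 (t / \<rho>) * laplace f (Complex (\<epsilon> n) t)" for n t
  have G_supp: "G n t = 0" if "4 * \<rho> < \<bar>t\<bar>" for n t
    using bspline_eq_0[of 3 "t / \<rho>"] that \<rho> by (simp add: G_def field_simps)
  have "((\<lambda>k. complex_of_real (LINT v|lborel. f (of_int k * pi / \<Lambda> - v / \<rho>) * jackson v)) \<longlongrightarrow> 0) cofinite"
  proof (rule dominated_riemann_lebesgue)
    show "0 < \<Lambda>" using \<Lambda> \<rho> by simp
    show "integrable lborel (\<lambda>t. 8 * norm (g t))" using g by simp
    show "G n \<in> borel_measurable borel" for n
      unfolding G_def laplace_eq_fourier by measurable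
    show "AE t in lborel. norm (G n t) \<le> 8 * norm (g t)" for n
      using g_ge[of n]
    proof eventually_elim
      case (elim t)
      show ?case
      proof (cases "4 * \<rho> < \<bar>t\<bar>")
        case False
        thus ?thesis using elim norm_bspline_le[of 3 "t / \<rho>"]
          by (auto simp: G_def norm_mult intro!: mult_mono)
      qed (simp add: G_supp)
    qed
    show "G n t = 0" if "\<Lambda> < \<bar>t\<bar>" for n t using G_supp[of t n] that \<Lambda> by simp
    show "(\<lambda>n. fourier (G n) (of_int k * pi / \<Lambda>)) \<longlonglongrightarrow>
        of_real (LINT v|lborel. f (of_int k * pi / \<Lambda> - v / \<rho>) * jackson v)" for k
      unfolding G_def by (rule fourier_bspline_mult_laplace_tendsto[OF \<rho> \<epsilon>(1) \<epsilon>_tendsto])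
  qed simp
  hence "((\<lambda>k::int. LINT v|lborel. f (of_int k * pi / \<Lambda> - v / \<rho>) * jackson v) \<longlongrightarrow> 0) cofinite"
    by (simp add: tendsto_of_real_iff[of _ 0, simplified])
  thus ?thesis unfolding mean_def by (rule tendsto_divide_zero)
qed

theorem tendsto_0:
  assumes dom: "laplace_boundary_dominated f"
  shows "(f \<longlongrightarrow> 0) at_top"
proof (rule tendstoI)
  fix e :: real assume "0 < e"
  hence third_pos: "0 < e / 3" by simp
  obtain \<rho> where \<rho>: "1 \<le> \<rho>" and approx: "\<forall>\<^sub>F h in at_top. \<bar>f h - mean \<rho> h\<bar> \<le> e / 3"
    using mean_approximates[OF third_pos] by blast
  obtain \<delta> U where \<delta>: "0 < \<delta>"
    and osc: "\<And>u v. U \<le> u \<Longrightarrow> U \<le> v \<Longrightarrow> \<bar>u - v\<bar> \<le> \<delta> \<Longrightarrow> \<bar>f u - f v\<bar> \<le> e / 3"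
    using slow[unfolded slowly_oscillating_def, rule_format, OF third_pos] by blast
  define \<Lambda> where "\<Lambda> = max (4 * \<rho>) (pi / \<delta>)"
  have \<Lambda>: "0 < \<Lambda>" "4 * \<rho> \<le> \<Lambda>" "pi / \<delta> \<le> \<Lambda>" using \<rho> by (auto simp: \<Lambda>_def)
  define d where "d = pi / \<Lambda>"
  have d: "0 < d" "d \<le> \<delta>" using \<Lambda> \<delta> by (auto simp: d_def field_simps)
  define grid where "grid u = of_int \<lfloor>u / d\<rfloor> * d" for u
  have grid: "grid u \<le> u" "u < grid u + d" for u
    using floor_divide_lower[OF d(1), of u] floor_divide_upper[OF d(1), of u]
    by (auto simp: grid_def distrib_right)
  have grid_at_top: "filterlim grid at_top at_top"
    unfolding grid_def by (rule filterlim_floor_divide_mult_at_top[OF d(1)])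
  have "((\<lambda>u. mean \<rho> (grid u)) \<longlongrightarrow> 0) at_top"
    using filterlim_compose[OF mean_tendsto_0_along_grid[OF dom \<rho> \<Lambda>(2)]
        filterlim_floor_divide_cofinite[OF d(1)]]
    by (simp add: grid_def d_def)
  hence "\<forall>\<^sub>F u in at_top. \<bar>mean \<rho> (grid u)\<bar> < e / 3"
    using third_pos by (intro order_tendstoD(2)[OF tendsto_rabs_zero]) auto
  moreover have "\<forall>\<^sub>F u in at_top. \<bar>f (grid u) - mean \<rho> (grid u)\<bar> \<le> e / 3"
    by (rule eventually_compose_filterlim[OF approx grid_at_top])
  moreover have "\<forall>\<^sub>F u in at_top. U + d \<le> u" by (rule eventually_ge_at_top)
  ultimately show "\<forall>\<^sub>F u in at_top. dist (f u) 0 < e"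
  proof eventually_elim
    case (elim u)
    have "\<bar>f u - f (grid u)\<bar> \<le> e / 3"
      using grid[of u] d elim(3) by (intro osc) auto
    thus ?case using elim(1,2) unfolding dist_real_def by linarith
  qed
qed

end

theorem tauberian_slowly_oscillating:
  assumes "f \<in> borel_measurable borel" and "\<And>u. u < 0 \<Longrightarrow> f u = 0" and "\<And>U. bounded (f ` {..U})"
    and "slowly_oscillating f" and "laplace_boundary_dominated f"
  shows "(f \<longlongrightarrow> 0) at_top"
proof -
  obtain A where "\<And>u v. \<bar>f u - f v\<bar> \<le> A * (1 + \<bar>u - v\<bar>)"
    using slowly_oscillating_increments_linear assms(3,4) by blast
  then interpret tauberian_function f A
    using assms by unfold_locales auto
  show ?thesis by (rule tendsto_0[OF assms(5)])
qed

subsection \<open>Summatory functions\<close>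

lemma borel_measurable_summatory:
  fixes lam c :: "'i \<Rightarrow> real"
  assumes fin: "\<And>x. finite {i. lam i \<le> x}"
  shows "(\<lambda>x. \<Sum>i | lam i \<le> x. c i) \<in> borel_measurable borel"
proof -
  have [measurable]: "(\<lambda>x. \<Sum>i | lam i \<le> x. w i) \<in> borel_measurable borel"
    if "\<And>i. 0 \<le> w i" for w :: "'i \<Rightarrow> real"
    by (intro borel_measurable_mono discrete_counting_mono fin that)
  have "(\<lambda>x. \<Sum>i | lam i \<le> x. c i) =
      (\<lambda>x. (\<Sum>i | lam i \<le> x. max 0 (c i)) - (\<Sum>i | lam i \<le> x. max 0 (- c i)))"
    by (simp add: fun_eq_iff max_def flip: sum_subtractf) (intro allI sum.cong; simp)
  also have "\<dots> \<in> borel_measurable borel" by measurable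
  finally show ?thesis .
qed

lemma lebesgue_integral_count_space_swap:
  fixes F :: "'i \<Rightarrow> 'a \<Rightarrow> 'b::{banach,second_countable_topology}"
  assumes M: "sigma_finite_measure M" and countable: "countable (UNIV :: 'i set)"
    and F: "\<And>i. integrable M (F i)" and sm: "(\<lambda>i. LINT x|M. norm (F i x)) summable_on UNIV"
  shows "(LINT x|M. LINT i|count_space UNIV. F i x) = (\<Sum>\<^sub>\<infinity>i. LINT x|M. F i x)"
proof -
  interpret pair_sigma_finite "count_space (UNIV :: 'i set)" M
    by (intro pair_sigma_finite.intro sigma_finite_measure_count_space_countable[OF countable] M)
  have F_measurable: "(\<lambda>(i, x). F i x) \<in> borel_measurable (count_space UNIV \<Otimes>\<^sub>M M)"
    by (rule measurable_pair_measure_countable1[OF countable]) (use F in auto)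
  have "integrable (count_space UNIV \<Otimes>\<^sub>M M) (\<lambda>(i, x). F i x)"
  proof (rule Fubini_integrable[OF F_measurable])
    show "integrable (count_space UNIV) (\<lambda>i. LINT x|M. norm (case (i, x) of (i, x) \<Rightarrow> F i x))"
      using sm by (simp add: abs_summable_equivalent[symmetric] flip: abs_summable_on_def)
  qed (use F in auto)
  hence "(LINT x|M. LINT i|count_space UNIV. F i x) = infsetsum (\<lambda>i. LINT x|M. F i x) UNIV"
    unfolding infsetsum_def by (rule Fubini_integral)
  also have "\<dots> = (\<Sum>\<^sub>\<infinity>i. LINT x|M. F i x)"
  proof (rule infsetsum_infsum, subst abs_summable_equivalent[symmetric])
    show "(\<lambda>i. norm (LINT x|M. F i x)) summable_on UNIV"
      by (rule summable_on_comparison_test[OF sm]) auto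
  qed
  finally show ?thesis .
qed

lemma laplace_summatory:
  fixes lam c :: "'i \<Rightarrow> real" and s :: complex
  assumes fin: "\<And>x. finite {i. lam i \<le> x}" and s: "0 < Re s"
    and sm: "(\<lambda>i. \<bar>c i\<bar> * exp (- Re s * lam i)) summable_on UNIV"
  shows "laplace (\<lambda>u. \<Sum>i | lam i \<le> u. c i) s =
    (\<Sum>\<^sub>\<infinity>i. of_real (c i) * exp (- s * of_real (lam i))) / s"
proof -
  define F where
    "F i u = complex_of_real (c i) * (of_real (indicator {lam i..} u) * exp (- s * of_real u))" for i u
  have countable: "countable (UNIV :: 'i set)"
  proof -
    have "(UNIV :: 'i set) = (\<Union>k::nat. {i. lam i \<le> real k})" by (auto simp: real_arch_simple)
    thus ?thesis by (metis countable_UN countable_finite fin countableI_type)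
  qed
  have F: "integrable lborel (F i)" for i
    unfolding F_def by (intro integrable_mult_right integrable_cexp_atLeast[OF s])
  have "(LINT u|lborel. norm (F i u)) = \<bar>c i\<bar> * exp (- Re s * lam i) / Re s" for i
    using integral_exp_atLeast[OF s, of "lam i"] by (simp add: F_def norm_mult)
  hence norm_F: "(\<lambda>i. LINT u|lborel. norm (F i u)) summable_on UNIV"
    using summable_on_cmult_left[OF sm, of "inverse (Re s)"] by (simp add: divide_inverse)
  have "(LINT i|count_space UNIV. F i u) = of_real (\<Sum>i | lam i \<le> u. c i) * exp (- s * of_real u)" for u
  proof -
    have "finite {i. F i u \<noteq> 0}"
      by (rule finite_subset[OF _ fin[of u]]) (auto simp: F_def indicator_def)
    hence "(LINT i|count_space UNIV. F i u) = (\<Sum>i | F i u \<noteq> 0. F i u)"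
      using lebesgue_integral_count_space_finite_support[of UNIV "\<lambda>i. F i u"] by simp
    also have "\<dots> = (\<Sum>i | lam i \<le> u. of_real (c i) * exp (- s * of_real u))"
      by (rule sum.mono_neutral_cong_left[OF fin]) (auto simp: F_def indicator_def)
    finally show ?thesis by (simp add: sum_distrib_right)
  qed
  hence "laplace (\<lambda>u. \<Sum>i | lam i \<le> u. c i) s = (LINT u|lborel. LINT i|count_space UNIV. F i u)"
    by (simp add: laplace_def)
  also have "\<dots> = (\<Sum>\<^sub>\<infinity>i. LINT u|lborel. F i u)"
    by (rule lebesgue_integral_count_space_swap[OF sigma_finite_lborel countable F norm_F])
  also have "\<dots> = (\<Sum>\<^sub>\<infinity>i. of_real (c i) * exp (- s * of_real (lam i)) * inverse s)"
    using laplace_indicator_atLeast[OF s] by (simp add: F_def laplace_def divide_inverse mult.assoc)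
  finally show ?thesis by (simp only: infsum_cmult_left' divide_inverse)
qed

lemma asymp_equiv_linear_increment_le:
  fixes N :: "real \<Rightarrow> real"
  assumes N: "N \<sim>[at_top] (\<lambda>x. a * x)" and a_pos: "0 < a" and e_pos: "0 < e"
  obtains \<kappa> X where "0 < \<kappa>" "0 < X"
    "\<And>x y. X \<le> x \<Longrightarrow> x \<le> y \<Longrightarrow> y \<le> (1 + \<kappa>) * x \<Longrightarrow> N y - N x \<le> e * x"
proof -
  define \<eta> where "\<eta> = e / 6"
  have \<eta>: "0 < \<eta>" using e_pos by (simp add: \<eta>_def)
  have "(\<lambda>x. N x - a * x) \<in> o(\<lambda>x. a * x)"
    by (rule asymp_equiv_imp_diff_smallo[OF N])
  from landau_o.smallD[OF this, of "\<eta> / a"]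
  have "\<forall>\<^sub>F x in at_top. norm (N x - a * x) \<le> \<eta> / a * norm (a * x)"
    using \<eta> a_pos by simp
  then obtain X where X: "\<And>x. X \<le> x \<Longrightarrow> norm (N x - a * x) \<le> \<eta> / a * norm (a * x)"
    by (auto simp: eventually_at_top_linorder)
  have dev: "\<bar>N x - a * x\<bar> \<le> \<eta> * x" if "max 1 X \<le> x" for x
    using X[of x] that a_pos by (simp add: abs_mult)
  define \<kappa> where "\<kappa> = min 1 (e / (2 * a))"
  have \<kappa>: "0 < \<kappa>" "\<kappa> \<le> 1" using a_pos e_pos by (auto simp: \<kappa>_def)
  have "a * \<kappa> \<le> a * (e / (2 * a))" unfolding \<kappa>_def using a_pos by (intro mult_left_mono) auto
  hence a\<kappa>_le: "a * \<kappa> \<le> e / 2" using a_pos by simp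
  show ?thesis
  proof (rule that[of \<kappa> "max 1 X"])
    fix x y assume xy: "max 1 X \<le> x" "x \<le> y" "y \<le> (1 + \<kappa>) * x"
    have "N y - N x \<le> (a + \<eta>) * y - (a - \<eta>) * x"
      using dev[of x] dev[of y] xy by (simp add: algebra_simps)
    also have "\<dots> \<le> (a + \<eta>) * ((1 + \<kappa>) * x) - (a - \<eta>) * x"
      using xy a_pos \<eta> by (intro diff_right_mono mult_left_mono) auto
    also have "\<dots> = (a * \<kappa> + \<eta> * \<kappa> + 2 * \<eta>) * x" by (simp add: algebra_simps)
    also have "\<dots> \<le> e * x"
    proof (rule mult_right_mono)
      have "\<eta> * \<kappa> \<le> \<eta>" using \<kappa> \<eta> by (simp add: mult_left_le)
      thus "a * \<kappa> + \<eta> * \<kappa> + 2 * \<eta> \<le> e" using a\<kappa>_le unfolding \<eta>_def by linarith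
    qed (use xy in simp)
    finally show "N y - N x \<le> e * x" .
  qed (use \<kappa> in simp_all)
qed

subsection \<open>The function \<open>m\<close> on a logarithmic scale\<close>

lemma abs_beurling_mu_le: "\<bar>beurling_mu A\<bar> \<le> 1"
  by (simp add: beurling_mu_def)

lemma beurling_N_mono: "beurling_primes p \<Longrightarrow> mono (beurling_N p)"
  unfolding beurling_N_eq_sum by (intro discrete_counting_mono finite_beurling_int_le) auto

lemma beurling_m_diff_le:
  assumes p: "beurling_primes p" and x: "0 < x" "x \<le> y"
  shows "\<bar>beurling_m p y - beurling_m p x\<bar> \<le> (beurling_N p y - beurling_N p x) / x"
proof -
  let ?Y = "{A. beurling_int p A \<le> y}" and ?X = "{A. beurling_int p A \<le> x}"
  have sub: "?X \<subseteq> ?Y" using x by auto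
  note fin = finite_beurling_int_le[OF p]
  have "\<bar>beurling_m p y - beurling_m p x\<bar> = \<bar>\<Sum>A\<in>?Y - ?X. beurling_mu A / beurling_int p A\<bar>"
    unfolding beurling_m_def by (subst sum_diff[OF fin sub]) (rule refl)
  also have "\<dots> \<le> (\<Sum>A\<in>?Y - ?X. 1 / x)"
  proof (rule order_trans[OF sum_abs sum_mono])
    fix A assume "A \<in> ?Y - ?X"
    hence "x < beurling_int p A" by auto
    thus "\<bar>beurling_mu A / beurling_int p A\<bar> \<le> 1 / x"
      using x abs_beurling_mu_le[of A] by (auto simp: abs_div intro!: frac_le)
  qed
  also have "\<dots> = (beurling_N p y - beurling_N p x) / x"
    using card_Diff_subset[OF fin sub] card_mono[OF fin sub]
    by (simp add: beurling_N_def of_nat_diff)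
  finally show ?thesis .
qed

lemma abs_beurling_m_le:
  assumes p: "beurling_primes p"
  shows "\<bar>beurling_m p x\<bar> \<le> beurling_N p x"
proof -
  have "\<bar>beurling_mu A / beurling_int p A\<bar> \<le> 1" for A
    using abs_beurling_mu_le[of A] beurling_int_ge_1[OF p, of A] by (simp add: abs_div divide_le_eq)
  thus ?thesis
    unfolding beurling_m_def beurling_N_eq_sum by (intro order_trans[OF sum_abs sum_mono])
qed

lemma beurling_m_eq_0: "beurling_primes p \<Longrightarrow> x < 1 \<Longrightarrow> beurling_m p x = 0"
  using beurling_int_ge_1[of p] unfolding beurling_m_def
  by (intro sum.neutral) (metis (mono_tags) mem_Collect_eq not_le order_trans)

lemma beurling_m_exp_eq_summatory:
  assumes p: "beurling_primes p"
  shows "beurling_m p (exp u) = (\<Sum>A | ln (beurling_int p A) \<le> u. beurling_mu A / beurling_int p A)"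
proof -
  have "beurling_int p A \<le> exp u \<longleftrightarrow> ln (beurling_int p A) \<le> u" for A
    using beurling_int_ge_1[OF p, of A] ln_le_cancel_iff[of "beurling_int p A" "exp u"] by simp
  thus ?thesis by (simp add: beurling_m_def)
qed

lemma finite_ln_beurling_int_le:
  assumes p: "beurling_primes p" shows "finite {A. ln (beurling_int p A) \<le> u}"
proof (rule finite_subset[OF _ finite_beurling_int_le[OF p, of "exp u"]], clarify)
  fix A assume "ln (beurling_int p A) \<le> u"
  thus "beurling_int p A \<le> exp u"
    using beurling_int_ge_1[OF p, of A] ln_le_cancel_iff[of "beurling_int p A" "exp u"] by simp
qed

lemma borel_measurable_beurling_m_exp:
  assumes p: "beurling_primes p" shows "(\<lambda>u. beurling_m p (exp u)) \<in> borel_measurable borel"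
  unfolding beurling_m_exp_eq_summatory[OF p]
  by (rule borel_measurable_summatory[OF finite_ln_beurling_int_le[OF p]])

lemma bounded_beurling_m_exp_atMost:
  assumes p: "beurling_primes p" shows "bounded ((\<lambda>u. beurling_m p (exp u)) ` {..U})"
proof -
  have "\<bar>beurling_m p (exp u)\<bar> \<le> beurling_N p (exp U)" if "u \<le> U" for u
    using abs_beurling_m_le[OF p, of "exp u"] monoD[OF beurling_N_mono[OF p], of "exp u" "exp U"] that
    by simp
  thus ?thesis by (auto simp: bounded_iff)
qed

lemma slowly_oscillating_beurling_m_exp:
  assumes p: "beurling_primes p" and N: "beurling_N p \<sim>[at_top] (\<lambda>x. a * x)" and a_pos: "0 < a"
  shows "slowly_oscillating (\<lambda>u. beurling_m p (exp u))"
  unfolding slowly_oscillating_def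
proof (intro allI impI)
  fix e :: real assume "0 < e"
  then obtain \<kappa> X where \<kappa>: "0 < \<kappa>" and X: "0 < X"
    and N_le: "\<And>x y. X \<le> x \<Longrightarrow> x \<le> y \<Longrightarrow> y \<le> (1 + \<kappa>) * x \<Longrightarrow> beurling_N p y - beurling_N p x \<le> e * x"
    using asymp_equiv_linear_increment_le[OF N a_pos] by blast
  have ordered: "\<bar>beurling_m p (exp v) - beurling_m p (exp u)\<bar> \<le> e"
    if uv: "ln X \<le> u" "u \<le> v" "v \<le> u + ln (1 + \<kappa>)" for u v
  proof -
    have "exp v \<le> exp (u + ln (1 + \<kappa>))" using uv by simp
    hence v: "exp v \<le> (1 + \<kappa>) * exp u" using \<kappa> by (simp add: exp_add mult.commute)
    have "X \<le> exp u" using uv X ln_le_cancel_iff[of X "exp u"] by simp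
    hence "beurling_N p (exp v) - beurling_N p (exp u) \<le> e * exp u" using uv v by (intro N_le) auto
    hence "(beurling_N p (exp v) - beurling_N p (exp u)) / exp u \<le> e" by (simp add: pos_divide_le_eq)
    thus ?thesis using beurling_m_diff_le[OF p, of "exp u" "exp v"] uv by simp
  qed
  show "\<exists>\<delta>>0. \<exists>U. \<forall>u\<ge>U. \<forall>v\<ge>U. \<bar>u - v\<bar> \<le> \<delta> \<longrightarrow> \<bar>beurling_m p (exp u) - beurling_m p (exp v)\<bar> \<le> e"
  proof (rule exI[of _ "ln (1 + \<kappa>)"], intro conjI exI[of _ "ln X"] allI impI)
    fix u v assume "ln X \<le> u" "ln X \<le> v" "\<bar>u - v\<bar> \<le> ln (1 + \<kappa>)"
    thus "\<bar>beurling_m p (exp u) - beurling_m p (exp v)\<bar> \<le> e"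
      using ordered[of u v] ordered[of v u] by (cases "u \<le> v") (simp_all add: abs_minus_commute)
  qed (use \<kappa> in simp)
qed

lemma laplace_beurling_m_exp:
  assumes p: "beurling_primes p" and N: "beurling_N p \<sim>[at_top] (\<lambda>x. a * x)" and s: "0 < Re s"
  shows "laplace (\<lambda>u. beurling_m p (exp u)) s = 1 / (s * beurling_zeta p (1 + s))"
proof -
  let ?n = "beurling_int p"
  have n_pos: "0 < ?n A" for A using beurling_int_ge_1[OF p, of A] by linarith
  have summand: "of_real (beurling_mu A / ?n A) * exp (- s * of_real (ln (?n A))) =
      of_real (beurling_mu A) * of_real (?n A) powr (- (1 + s))" for A
  proof -
    have "- (1 + s) = - s - 1" by simp
    hence "of_real (?n A) powr (- (1 + s)) = of_real (?n A) powr (- s) / of_real (?n A)"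
      using n_pos[of A] by (simp only: powr_diff powr_one) simp
    moreover have "of_real (?n A) powr (- s) = exp (- s * of_real (ln (?n A)))"
      using n_pos[of A] by (simp add: powr_def Ln_of_real)
    ultimately show ?thesis by simp
  qed
  have "(\<lambda>A. \<bar>beurling_mu A / ?n A\<bar> * exp (- Re s * ln (?n A))) summable_on UNIV"
  proof (rule summable_on_comparison_test)
    show "(\<lambda>A. ?n A powr (- (1 + Re s))) summable_on UNIV"
      using s by (intro beurling_int_powr_summable[OF p N]) simp
    show "\<bar>beurling_mu A / ?n A\<bar> * exp (- Re s * ln (?n A)) \<le> ?n A powr (- (1 + Re s))" for A
    proof -
      have "\<bar>beurling_mu A / ?n A\<bar> * exp (- Re s * ln (?n A)) \<le> 1 / ?n A * exp (- Re s * ln (?n A))"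
        using n_pos[of A] abs_beurling_mu_le[of A]
        by (intro mult_right_mono) (auto simp: abs_div divide_right_mono)
      also have "\<dots> = ?n A powr (- (1 + Re s))"
        using n_pos[of A] by (simp add: powr_def distrib_right exp_diff exp_minus field_simps exp_add)
      finally show ?thesis .
    qed
  qed simp
  hence "laplace (\<lambda>u. beurling_m p (exp u)) s =
      (\<Sum>\<^sub>\<infinity>A. of_real (beurling_mu A) * of_real (?n A) powr (- (1 + s))) / s"
    unfolding beurling_m_exp_eq_summatory[OF p] summand[symmetric]
    by (rule laplace_summatory[OF finite_ln_beurling_int_le[OF p] s])
  also have "(\<Sum>\<^sub>\<infinity>A. of_real (beurling_mu A) * of_real (?n A) powr (- (1 + s))) =
      1 / beurling_zeta p (1 + s)"
    using s by (intro beurling_zeta_identities(2)[OF p N]) simp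
  finally show ?thesis by simp
qed

subsection \<open>Integrable majorants with power singularities\<close>

lemma prod_powr_singularities_le:
  fixes b :: "real \<Rightarrow> real"
  assumes F: "finite F" and b: "\<And>\<tau>. \<tau> \<in> F \<Longrightarrow> 0 \<le> b \<tau>"
  obtains C where
    "\<And>t. (\<Prod>\<tau>\<in>F. \<bar>t - \<tau>\<bar> powr (- b \<tau>)) \<le> C * (1 + (\<Sum>\<tau>\<in>F. \<bar>t - \<tau>\<bar> powr (- b \<tau>)))"
proof -
  define D where "D \<sigma> = (\<Prod>\<tau>\<in>F - {\<sigma>}. (\<bar>\<tau> - \<sigma>\<bar> / 2) powr (- b \<tau>))" for \<sigma>
  have D_nonneg: "0 \<le> D \<sigma>" for \<sigma> by (simp add: D_def prod_nonneg)
  show ?thesis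
  proof (rule that[of "1 + sum D F"])
    fix t
    let ?w = "\<lambda>\<tau>. \<bar>t - \<tau>\<bar> powr (- b \<tau>)"
    show "prod ?w F \<le> (1 + sum D F) * (1 + sum ?w F)"
    proof (cases "F = {}")
      case False
      then obtain \<sigma> where \<sigma>: "\<sigma> \<in> F" and nearest: "\<And>\<tau>. \<tau> \<in> F \<Longrightarrow> \<bar>t - \<sigma>\<bar> \<le> \<bar>t - \<tau>\<bar>"
        using arg_min_if_finite[OF F, of "\<lambda>\<tau>. \<bar>t - \<tau>\<bar>"] by (metis not_le)
      have "prod ?w F = ?w \<sigma> * prod ?w (F - {\<sigma>})" by (rule prod.remove[OF F \<sigma>])
      also have "\<dots> \<le> ?w \<sigma> * D \<sigma>"
        unfolding D_def
      proof (intro mult_left_mono prod_mono conjI)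
        fix \<tau> assume \<tau>: "\<tau> \<in> F - {\<sigma>}"
        hence "\<bar>\<tau> - \<sigma>\<bar> / 2 \<le> \<bar>t - \<tau>\<bar>"
          using nearest[of \<tau>] abs_triangle_ineq4[of "t - \<sigma>" "t - \<tau>"] by simp
        thus "?w \<tau> \<le> (\<bar>\<tau> - \<sigma>\<bar> / 2) powr (- b \<tau>)" using \<tau> b by (intro powr_mono2') auto
      qed auto
      also have "\<dots> \<le> (1 + sum ?w F) * (1 + sum D F)"
        using member_le_sum[OF \<sigma>, of ?w] member_le_sum[OF \<sigma>, of D] sum_nonneg[of F ?w] F D_nonneg
        by (intro mult_mono) auto
      finally show ?thesis by (simp only: mult.commute)
    qed simp
  qed
qed

lemma integrable_abs_powr:
  fixes b \<tau> R :: real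
  assumes b: "b < 1"
  shows "integrable lborel (\<lambda>t. \<bar>t - \<tau>\<bar> powr (- b) * indicator {-R..R} t)"
proof (cases "0 \<le> R")
  case True
  define Q where "Q = R + \<bar>\<tau>\<bar>"
  have Q_nonneg: "0 \<le> Q" using True by (simp add: Q_def)
  have "(\<lambda>x. x powr (- b)) absolutely_integrable_on {0..Q}"
    using integrable_on_powr_from_0[of "- b" Q] b Q_nonneg
    by (intro nonnegative_absolutely_integrable_1) auto
  hence right: "integrable lborel (\<lambda>x. indicator {0..Q} x * x powr (- b))"
    unfolding set_integrable_def by (subst (asm) integrable_completion) simp_all
  have left: "integrable lborel (\<lambda>x. indicator {0..Q} (- x) * (- x) powr (- b))"
    using lborel_integrable_real_affine[OF right, of "-1" 0] by simp
  have "integrable lborel (\<lambda>x. \<bar>x\<bar> powr (- b) * indicator {-Q..Q} x)"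
    by (rule Bochner_Integration.integrable_bound[OF Bochner_Integration.integrable_add[OF right left]])
       (auto simp: indicator_def)
  from lborel_integrable_real_affine[OF this, of 1 "- \<tau>"]
  have "integrable lborel (\<lambda>t. \<bar>t - \<tau>\<bar> powr (- b) * indicator {-Q..Q} (t - \<tau>))" by simp
  thus ?thesis
    by (rule Bochner_Integration.integrable_bound) (auto simp: indicator_def Q_def)
qed simp

lemma powr_uminus_le_singularity:
  fixes \<beta> R w d :: real
  assumes w: "0 < d" "d \<le> w" "w \<le> R" and R: "1 \<le> R"
  shows "w powr (- \<beta>) \<le> R powr \<bar>\<beta>\<bar> * d powr (- max \<beta> 0)"
proof (cases "0 \<le> \<beta>")
  case True
  have "w powr (- \<beta>) \<le> 1 * d powr (- \<beta>)" using w True by (simp add: powr_mono2')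
  also have "\<dots> \<le> R powr \<beta> * d powr (- \<beta>)"
    using R True by (intro mult_right_mono ge_one_powr_ge_zero) auto
  finally show ?thesis using True by simp
next
  case False
  have "w powr (- \<beta>) \<le> R powr (- \<beta>)" using w False by (intro powr_mono2) auto
  thus ?thesis using False w by simp
qed

lemma prod_cmod_powr_le:
  fixes \<beta> :: "real \<Rightarrow> real" and \<epsilon> t T :: real
  assumes \<epsilon>: "0 < \<epsilon>" "\<epsilon> < 1" and t: "\<bar>t\<bar> \<le> T" "t \<notin> F"
  shows "(\<Prod>\<tau>\<in>F. cmod (Complex \<epsilon> (t - \<tau>)) powr (- \<beta> \<tau>)) \<le>
    (\<Prod>\<tau>\<in>F. (1 + T + \<bar>\<tau>\<bar>) powr \<bar>\<beta> \<tau>\<bar>) * (\<Prod>\<tau>\<in>F. \<bar>t - \<tau>\<bar> powr (- max (\<beta> \<tau>) 0))"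
  unfolding prod.distrib[symmetric]
proof (intro prod_mono conjI)
  fix \<tau> assume "\<tau> \<in> F"
  hence "0 < \<bar>t - \<tau>\<bar>" using t(2) by auto
  moreover have "\<bar>t - \<tau>\<bar> \<le> cmod (Complex \<epsilon> (t - \<tau>))"
    using abs_Im_le_cmod[of "Complex \<epsilon> (t - \<tau>)"] by simp
  moreover have "cmod (Complex \<epsilon> (t - \<tau>)) \<le> 1 + T + \<bar>\<tau>\<bar>"
    using cmod_le[of "Complex \<epsilon> (t - \<tau>)"] \<epsilon> t(1) by simp
  ultimately show "cmod (Complex \<epsilon> (t - \<tau>)) powr (- \<beta> \<tau>) \<le>
      (1 + T + \<bar>\<tau>\<bar>) powr \<bar>\<beta> \<tau>\<bar> * \<bar>t - \<tau>\<bar> powr (- max (\<beta> \<tau>) 0)"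
    using t(1) by (intro powr_uminus_le_singularity) auto
qed simp

lemma prod_cmod_powr_dominated:
  fixes \<beta> :: "real \<Rightarrow> real" and T :: real
  assumes F: "finite F" and \<beta>: "\<And>\<tau>. \<tau> \<in> F \<Longrightarrow> \<beta> \<tau> < 1"
  obtains g where "integrable lborel g"
    "\<And>\<epsilon> t. 0 < \<epsilon> \<Longrightarrow> \<epsilon> < 1 \<Longrightarrow> \<bar>t\<bar> \<le> T \<Longrightarrow> t \<notin> F \<Longrightarrow>
      (\<Prod>\<tau>\<in>F. cmod (Complex \<epsilon> (t - \<tau>)) powr (- \<beta> \<tau>)) \<le> g t"
proof -
  let ?w = "\<lambda>t \<tau>. \<bar>t - \<tau>\<bar> powr (- max (\<beta> \<tau>) 0)"
  define D where "D = (\<Prod>\<tau>\<in>F. (1 + T + \<bar>\<tau>\<bar>) powr \<bar>\<beta> \<tau>\<bar>)"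
  have D_nonneg: "0 \<le> D" by (simp add: D_def prod_nonneg)
  obtain C where prod_le: "\<And>t. (\<Prod>\<tau>\<in>F. ?w t \<tau>) \<le> C * (1 + (\<Sum>\<tau>\<in>F. ?w t \<tau>))"
    using prod_powr_singularities_le[OF F, of "\<lambda>\<tau>. max (\<beta> \<tau>) 0"] by auto
  define g where "g t = D * (C * (indicator {-T..T} t + (\<Sum>\<tau>\<in>F. ?w t \<tau> * indicator {-T..T} t)))" for t
  show ?thesis
  proof (rule that[of g])
    have "integrable lborel (indicat_real {-T..T})" by (cases "-T \<le> T") auto
    thus "integrable lborel g"
      unfolding g_def using \<beta>
      by (intro integrable_mult_right Bochner_Integration.integrable_add
            Bochner_Integration.integrable_sum integrable_abs_powr) auto
    fix \<epsilon> t :: real assume \<epsilon>: "0 < \<epsilon>" "\<epsilon> < 1" and t: "\<bar>t\<bar> \<le> T" "t \<notin> F"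
    have "(\<Prod>\<tau>\<in>F. cmod (Complex \<epsilon> (t - \<tau>)) powr (- \<beta> \<tau>)) \<le> D * (\<Prod>\<tau>\<in>F. ?w t \<tau>)"
      unfolding D_def by (rule prod_cmod_powr_le[OF \<epsilon> t])
    also have "\<dots> \<le> D * (C * (1 + (\<Sum>\<tau>\<in>F. ?w t \<tau>)))"
      by (intro mult_left_mono prod_le D_nonneg)
    also have "\<dots> = g t" using t(1) by (simp add: g_def abs_le_iff)
    finally show "(\<Prod>\<tau>\<in>F. cmod (Complex \<epsilon> (t - \<tau>)) powr (- \<beta> \<tau>)) \<le> g t" .
  qed
qed

subsection \<open>Domination of the Laplace transform of \<open>m\<close>\<close>

lemma laplace_boundary_dominatedI:
  assumes dom: "\<And>T. 0 < T \<Longrightarrow> \<exists>g F. integrable lborel g \<and> finite F \<and>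
    (\<forall>\<epsilon>\<in>{0<..<1}. \<forall>t\<in>{0<..<T} - F. norm (laplace f (Complex \<epsilon> t)) \<le> g t)"
  shows "laplace_boundary_dominated f"
  unfolding laplace_boundary_dominated_def
proof (intro allI impI)
  fix T :: real assume "0 < T"
  then obtain g F where g: "integrable lborel g" and F: "finite F"
    and g_ge: "\<And>\<epsilon> t. \<epsilon> \<in> {0<..<1} \<Longrightarrow> t \<in> {0<..<T} - F \<Longrightarrow> norm (laplace f (Complex \<epsilon> t)) \<le> g t"
    using dom by meson
  show "\<exists>g. integrable lborel g \<and>
      (\<forall>\<epsilon>\<in>{0<..<1}. AE t in lborel. \<bar>t\<bar> < T \<longrightarrow> norm (laplace f (Complex \<epsilon> t)) \<le> g t)"
  proof (intro exI[of _ "\<lambda>t. \<bar>g t\<bar> + \<bar>g (- t)\<bar>"] conjI ballI)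
    show "integrable lborel (\<lambda>t. \<bar>g t\<bar> + \<bar>g (- t)\<bar>)"
      using g lborel_integrable_real_affine[OF g, of "-1" 0] by simp
    fix \<epsilon> :: real assume \<epsilon>: "\<epsilon> \<in> {0<..<1}"
    have "AE t in lborel. t \<notin> insert 0 (F \<union> uminus ` F)"
      using F by (intro AE_not_in finite_imp_null_set_lborel) auto
    thus "AE t in lborel. \<bar>t\<bar> < T \<longrightarrow> norm (laplace f (Complex \<epsilon> t)) \<le> \<bar>g t\<bar> + \<bar>g (- t)\<bar>"
    proof eventually_elim
      case (elim t)
      have "norm (laplace f (Complex \<epsilon> (- t))) = norm (laplace f (Complex \<epsilon> t))"
        using laplace_cnj[of f "Complex \<epsilon> t"] by (simp add: complex_cnj)
      moreover have "t \<notin> F" "- t \<notin> F" "t \<noteq> 0" using elim by (auto simp: image_iff)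
      ultimately show ?case using g_ge[OF \<epsilon>, of t] g_ge[OF \<epsilon>, of "- t"] by (cases "0 < t") auto
    qed
  qed
qed

lemma norm_laplace_beurling_m_exp_le:
  assumes p: "beurling_primes p" and N: "beurling_N p \<sim>[at_top] (\<lambda>x. a * x)"
    and \<epsilon>: "0 < \<epsilon>" and F: "finite F"
    and lower: "- K - ln (cmod (Complex \<epsilon> t)) + (\<Sum>\<tau>\<in>F. \<beta> \<tau> * ln (cmod (Complex \<epsilon> (t - \<tau>))))
      < ln (cmod (beurling_zeta p (Complex (1 + \<epsilon>) t)))"
  shows "norm (laplace (\<lambda>u. beurling_m p (exp u)) (Complex \<epsilon> t)) \<le>
    exp K * (\<Prod>\<tau>\<in>F. cmod (Complex \<epsilon> (t - \<tau>)) powr (- \<beta> \<tau>))"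
proof -
  let ?\<zeta> = "beurling_zeta p (Complex (1 + \<epsilon>) t)"
  have nonzero: "Complex \<epsilon> v \<noteq> 0" for v using \<epsilon> by (simp add: complex_eq_iff)
  have \<zeta>: "?\<zeta> \<noteq> 0"
    using beurling_zeta_identities(1)[OF p N, of "Complex (1 + \<epsilon>) t"] \<epsilon> by simp
  have "1 + Complex \<epsilon> t = Complex (1 + \<epsilon>) t" by (simp add: complex_eq_iff)
  hence "norm (laplace (\<lambda>u. beurling_m p (exp u)) (Complex \<epsilon> t)) =
      inverse (norm (Complex \<epsilon> t)) * inverse (norm ?\<zeta>)"
    using laplace_beurling_m_exp[OF p N, of "Complex \<epsilon> t"] \<epsilon>
    by (simp add: norm_mult norm_inverse divide_inverse)
  also have "\<dots> = exp (- ln (norm (Complex \<epsilon> t)) - ln (norm ?\<zeta>))"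
    using nonzero \<zeta> by (simp add: exp_diff exp_minus divide_inverse)
  also have "\<dots> \<le> exp (K + (\<Sum>\<tau>\<in>F. - \<beta> \<tau> * ln (cmod (Complex \<epsilon> (t - \<tau>)))))"
    using lower by (simp add: sum_negf)
  also have "\<dots> = exp K * (\<Prod>\<tau>\<in>F. cmod (Complex \<epsilon> (t - \<tau>)) powr (- \<beta> \<tau>))"
    using F nonzero by (simp add: exp_add exp_sum powr_def)
  finally show ?thesis .
qed

lemma laplace_boundary_dominated_beurling_m_exp:
  fixes \<beta> :: "real \<Rightarrow> real"
  assumes p: "beurling_primes p" and N: "beurling_N p \<sim>[at_top] (\<lambda>x. a * x)"
    and S: "\<And>T. finite {\<tau> \<in> S. \<tau> < T}" and \<beta>: "\<And>\<tau>. \<tau> \<in> S \<Longrightarrow> \<beta> \<tau> < 1"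
    and lower: "\<And>T. 0 < T \<Longrightarrow> \<exists>K>0. \<forall>t \<sigma>. 0 < t \<and> t < T \<and> 1 < \<sigma> \<and> \<sigma> < 2 \<longrightarrow>
      ln (cmod (beurling_zeta p (Complex \<sigma> t))) >
        - K - ln (cmod (Complex (\<sigma> - 1) t))
        + (\<Sum>\<tau> \<in> {\<tau> \<in> S. \<tau> < T}. \<beta> \<tau> * ln (cmod (Complex (\<sigma> - 1) (t - \<tau>))))"
  shows "laplace_boundary_dominated (\<lambda>u. beurling_m p (exp u))"
proof (rule laplace_boundary_dominatedI)
  fix T :: real assume T: "0 < T"
  define F where "F = {\<tau> \<in> S. \<tau> < T}"
  have F: "finite F" "\<And>\<tau>. \<tau> \<in> F \<Longrightarrow> \<beta> \<tau> < 1" using S \<beta> by (auto simp: F_def)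
  obtain K where K: "\<And>t \<sigma>. 0 < t \<Longrightarrow> t < T \<Longrightarrow> 1 < \<sigma> \<Longrightarrow> \<sigma> < 2 \<Longrightarrow>
      - K - ln (cmod (Complex (\<sigma> - 1) t)) + (\<Sum>\<tau>\<in>F. \<beta> \<tau> * ln (cmod (Complex (\<sigma> - 1) (t - \<tau>))))
      < ln (cmod (beurling_zeta p (Complex \<sigma> t)))"
    using lower[OF T, folded F_def] by blast
  obtain g where g: "integrable lborel g"
    and g_ge: "\<And>\<epsilon> t. 0 < \<epsilon> \<Longrightarrow> \<epsilon> < 1 \<Longrightarrow> \<bar>t\<bar> \<le> T \<Longrightarrow> t \<notin> F \<Longrightarrow>
      (\<Prod>\<tau>\<in>F. cmod (Complex \<epsilon> (t - \<tau>)) powr (- \<beta> \<tau>)) \<le> g t"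
    using prod_cmod_powr_dominated[where \<beta> = \<beta> and T = T, OF F] by blast
  have "norm (laplace (\<lambda>u. beurling_m p (exp u)) (Complex \<epsilon> t)) \<le> exp K * g t"
    if \<epsilon>: "\<epsilon> \<in> {0<..<1}" and t: "t \<in> {0<..<T} - F" for \<epsilon> t
  proof -
    have "norm (laplace (\<lambda>u. beurling_m p (exp u)) (Complex \<epsilon> t)) \<le>
        exp K * (\<Prod>\<tau>\<in>F. cmod (Complex \<epsilon> (t - \<tau>)) powr (- \<beta> \<tau>))"
      using \<epsilon> t F(1) K[of t "1 + \<epsilon>"] by (intro norm_laplace_beurling_m_exp_le[OF p N]) auto
    also have "\<dots> \<le> exp K * g t" using \<epsilon> t by (intro mult_left_mono g_ge) auto
    finally show ?thesis .
  qed
  moreover have "integrable lborel (\<lambda>t. exp K * g t)" using g by simp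
  ultimately show "\<exists>g F. integrable lborel g \<and> finite F \<and> (\<forall>\<epsilon>\<in>{0<..<1}. \<forall>t\<in>{0<..<T} - F.
      norm (laplace (\<lambda>u. beurling_m p (exp u)) (Complex \<epsilon> t)) \<le> g t)"
    using F(1) by blast
qed

theorem theorem5p1:
  fixes p :: "nat \<Rightarrow> real" and a :: real and S :: "real set" and \<beta> :: "real \<Rightarrow> real"
  assumes "beurling_primes p"
    and "a > 0"
    and "beurling_N p \<sim>[at_top] (\<lambda>x. a * x)"
    and "S \<subseteq> {0<..}"
    and "\<And>T. finite {\<tau> \<in> S. \<tau> < T}"
    and "\<And>\<tau>. \<tau> \<in> S \<Longrightarrow> \<beta> \<tau> < 1"
    and "\<And>T. T > 0 \<Longrightarrow> \<exists>K>0. \<forall>t \<sigma>. 0 < t \<and> t < T \<and> 1 < \<sigma> \<and> \<sigma> < 2 \<longrightarrow>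
           ln (cmod (beurling_zeta p (Complex \<sigma> t))) >
             - K - ln (cmod (Complex (\<sigma> - 1) t))
             + (\<Sum>\<tau> \<in> {\<tau> \<in> S. \<tau> < T}. \<beta> \<tau> * ln (cmod (Complex (\<sigma> - 1) (t - \<tau>))))"
  shows "(beurling_m p \<longlongrightarrow> 0) at_top"
proof -
  note p = assms(1) and N = assms(3)
  have "((\<lambda>u. beurling_m p (exp u)) \<longlongrightarrow> 0) at_top"
  proof (rule tauberian_slowly_oscillating)
    show "slowly_oscillating (\<lambda>u. beurling_m p (exp u))"
      by (rule slowly_oscillating_beurling_m_exp[OF p N assms(2)])
    show "laplace_boundary_dominated (\<lambda>u. beurling_m p (exp u))"
      by (rule laplace_boundary_dominated_beurling_m_exp[OF p N assms(5,6,7)])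
    show "beurling_m p (exp u) = 0" if "u < 0" for u using that by (simp add: beurling_m_eq_0[OF p])
  qed (intro borel_measurable_beurling_m_exp bounded_beurling_m_exp_atMost p)+
  hence "((\<lambda>x. beurling_m p (exp (ln x))) \<longlongrightarrow> 0) at_top" by (rule filterlim_compose[OF _ ln_at_top])
  moreover have "\<forall>\<^sub>F x in at_top. beurling_m p (exp (ln x)) = beurling_m p x"
    using eventually_gt_at_top[of 0] by eventually_elim simp
  ultimately show ?thesis by (rule Lim_transform_eventually)
qed

end
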